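(* Let $\mathbf{k}$ be a commutative unitary ring, $\lambda\in\mathbf{k}$, and let $X$ be a set. Let $\mathrm{Sh}^{NC}(X)$ be the free unitary and $\mathrm{Sh}^{NC,0}(X)$ the free nonunitary Rota--Baxter algebra of weight $\lambda$ on $X$ (realized by decorated forests as in the context), with canonical embeddings $\tilde{j}_X:X\to\mathrm{Sh}^{NC}(X)$ and $j_X:X\to\mathrm{Sh}^{NC,0}(X)$. Let $u_X:\mathrm{Sh}^{NC,0}(X)\to\mathrm{Sh}^{NC}(X)$ be the unique homomorphism of nonunitary Rota--Baxter algebras such that $\tilde{j}_X=u_X\circ j_X$. Then the unitary Rota--Baxter algebra $\mathrm{Sh}^{NC}(X)$, with the homomorphism $u_X$, is the unitarization of the nonunitary Rota--Baxter algebra $\mathrm{Sh}^{NC,0}(X)$.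
   Context: Rota--Baxter algebra of weight $\lambda$: an associative $\mathbf{k}$-algebra $R$ with a $\mathbf{k}$-linear map $P:R\to R$ such that $P(x)P(y)=P\big(P(x)y+xP(y)+\lambda xy\big)$ for all $x,y\in R$. It is unitary if $R$ has an identity; nonunitary means no identity is required. Homomorphisms of nonunitary Rota--Baxter algebras are $\mathbf{k}$-linear multiplicative maps commuting with the operators; homomorphisms of unitary Rota--Baxter algebras moreover preserve the identity. All Rota--Baxter algebras below have weight $\lambda$. Unitarization: for a nonunitary Rota--Baxter algebra $(A,P)$, a unitarization of $A$ is a unitary Rota--Baxter algebra $(\tilde A,\tilde P)$ with a nonunitary Rota--Baxter algebra homomorphism $u_A:A\to\tilde A$ such that for any unitary Rota--Baxter algebra $B$ and any homomorphism $f:A\to B$ of nonunitary Rota--Baxter algebras, there is a unique homomorphism $\tilde f:\tilde A\to B$ of unitary Rota--Baxter algebras with $f=\tilde f\circ u_A$. Free objects: $(\mathrm{Sh}^{NC}(X),\tilde j_X)$ has the universal property that every map from $X$ to a unitary Rota--Baxter algebra $R$ factors uniquely as $\bar f\circ\tilde j_X$ with $\bar f$ a homomorphism of unitary Rota--Baxter algebras; $(\mathrm{Sh}^{NC,0}(X),j_X)$ has the analogous property for nonunitary Rota--Baxter algebras. Realization. $\mathcal{T}$ is the set of planar rooted trees, $\bullet$ the one-vertex tree, $\mathcal{F}$ the free semigroup on $\mathcal{T}$ with product $\sqcup$ (elements are planar rooted forests), $\lfloor T_1\sqcup\cdots\sqcup T_b\rfloor$ is the tree obtained by joining a new root to the roots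 of $T_1,\dots,T_b$; every tree is $\bullet$ or $\lfloor\overline F\rfloor$ for a unique forest $\overline F$. $\ell(F)$ is the number of leaves ($\ell(\bullet)=1$). On $\mathbf{k}\,\mathcal{F}$ the bilinear product $\diamond$ is defined recursively (on the sum of the depths) by: for trees, $F\diamond\bullet=F$, $\bullet\diamond F'=F'$, $\lfloor\overline F\rfloor\diamond\lfloor\overline F'\rfloor=\lfloor\lfloor\overline F\rfloor\diamond\overline F'\rfloor+\lfloor\overline F\diamond\lfloor\overline F'\rfloor\rfloor+\lambda\lfloor\overline F\diamond\overline F'\rfloor$; for forests, $(T_1\sqcup\cdots\sqcup T_b)\diamond(T'_1\sqcup\cdots\sqcup T'_{b'})=T_1\sqcup\cdots\sqcup T_{b-1}\sqcup(T_b\diamond T'_1)\sqcup T'_2\sqcup\cdots\sqcup T'_{b'}$ (with $\sqcup$, $\lfloor\ \rfloor$ extended (bi)linearly). $\mathrm{Sh}^{NC}(X)$ is the free $\mathbf{k}$-module on the pairs $(F;\vec x)$ with $F\in\mathcal{F}$, $\vec x\in X^{\ell(F)-1}$ ($X^0$ consisting of the empty tuple), with bilinear product $(F;\vec x)\,\overline\diamond\,(F';\vec x')=(F\diamond F';(\vec x,\vec x'))$ (linear in the first entry; tuples concatenated), operator $(F;\vec x)\mapsto(\lfloor F\rfloor;\vec x)$, and $\tilde j_X(x)=(\bullet\sqcup\bullet;(x))$. $\mathrm{Sh}^{NC,0}(X)$ is the submodule spanned by the $(F;\vec x)$ with $F\in\mathcal{F}^0$, with the restricted product and operator and $j_X(x)=(\bullet\sqcup\bullet;(x))$;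 here $\mathcal{F}^0$ is the set of forests $F\neq\bullet$ in which no bracket $\lfloor B\rfloor$ occurring in $F$ equals $\lfloor\bullet\rfloor$ (no vertex has exactly one child with that child a leaf). *)

theory Defs
  imports "HOL-Algebra.Module"
begin

section \<open>Rota--Baxter algebras\<close>

record ('a, 'b) rb = "('a, 'b) module" +
  rbop :: "'b \<Rightarrow> 'b"

text \<open>
  No identity is required, so the field \<^const>\<open>one\<close> of a nonunitary algebra is ignored; a unitary
  algebra is one in which this field holds a two-sided identity. The zero algebra is allowed.
\<close>

locale rota_baxter = "module" k R
  for k (structure) and lam and R :: "('a, 'b, 'c) rb_scheme" (structure) +
  assumes weight_closed: "lam \<in> carrier k"
    and mult_closed: "\<lbrakk>x \<in> carrier R; y \<in> carrier R\<rbrakk> \<Longrightarrow> x \<otimes>\<^bsub>R\<^esub> y \<in> carrier R"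
    and mult_assoc: "\<lbrakk>x \<in> carrier R; y \<in> carrier R; z \<in> carrier R\<rbrakk>
      \<Longrightarrow> (x \<otimes>\<^bsub>R\<^esub> y) \<otimes>\<^bsub>R\<^esub> z = x \<otimes>\<^bsub>R\<^esub> (y \<otimes>\<^bsub>R\<^esub> z)"
    and mult_add_left: "\<lbrakk>x \<in> carrier R; y \<in> carrier R; z \<in> carrier R\<rbrakk>
      \<Longrightarrow> (x \<oplus>\<^bsub>R\<^esub> y) \<otimes>\<^bsub>R\<^esub> z = x \<otimes>\<^bsub>R\<^esub> z \<oplus>\<^bsub>R\<^esub> y \<otimes>\<^bsub>R\<^esub> z"
    and mult_add_right: "\<lbrakk>x \<in> carrier R; y \<in> carrier R; z \<in> carrier R\<rbrakk>
      \<Longrightarrow> x \<otimes>\<^bsub>R\<^esub> (y \<oplus>\<^bsub>R\<^esub> z) = x \<otimes>\<^bsub>R\<^esub> y \<oplus>\<^bsub>R\<^esub> x \<otimes>\<^bsub>R\<^esub> z"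
    and mult_smult_left: "\<lbrakk>c \<in> carrier k; x \<in> carrier R; y \<in> carrier R\<rbrakk>
      \<Longrightarrow> (c \<odot>\<^bsub>R\<^esub> x) \<otimes>\<^bsub>R\<^esub> y = c \<odot>\<^bsub>R\<^esub> (x \<otimes>\<^bsub>R\<^esub> y)"
    and mult_smult_right: "\<lbrakk>c \<in> carrier k; x \<in> carrier R; y \<in> carrier R\<rbrakk>
      \<Longrightarrow> x \<otimes>\<^bsub>R\<^esub> (c \<odot>\<^bsub>R\<^esub> y) = c \<odot>\<^bsub>R\<^esub> (x \<otimes>\<^bsub>R\<^esub> y)"
    and rbop_closed: "x \<in> carrier R \<Longrightarrow> rbop R x \<in> carrier R"
    and rbop_add: "\<lbrakk>x \<in> carrier R; y \<in> carrier R\<rbrakk>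
      \<Longrightarrow> rbop R (x \<oplus>\<^bsub>R\<^esub> y) = rbop R x \<oplus>\<^bsub>R\<^esub> rbop R y"
    and rbop_smult: "\<lbrakk>c \<in> carrier k; x \<in> carrier R\<rbrakk>
      \<Longrightarrow> rbop R (c \<odot>\<^bsub>R\<^esub> x) = c \<odot>\<^bsub>R\<^esub> rbop R x"
    and rota_baxter_identity: "\<lbrakk>x \<in> carrier R; y \<in> carrier R\<rbrakk>
      \<Longrightarrow> rbop R x \<otimes>\<^bsub>R\<^esub> rbop R y =
        rbop R (rbop R x \<otimes>\<^bsub>R\<^esub> y \<oplus>\<^bsub>R\<^esub> x \<otimes>\<^bsub>R\<^esub> rbop R y \<oplus>\<^bsub>R\<^esub> lam \<odot>\<^bsub>R\<^esub> (x \<otimes>\<^bsub>R\<^esub> y))"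

locale unitary_rota_baxter = rota_baxter k lam R + monoid R
  for k (structure) and lam and R (structure)

text \<open>
  Homomorphisms are taken in the extensional function space, so that equality of homomorphisms
  is equality of maps between the carriers.
\<close>

definition rb_hom :: "('a, 'm) ring_scheme \<Rightarrow> ('a, 'b, 'c) rb_scheme \<Rightarrow> ('a, 'd, 'e) rb_scheme
    \<Rightarrow> ('b \<Rightarrow> 'd) set" where
  "rb_hom k A B = {f \<in> carrier A \<rightarrow>\<^sub>E carrier B.
     (\<forall>x\<in>carrier A. \<forall>y\<in>carrier A. f (x \<oplus>\<^bsub>A\<^esub> y) = f x \<oplus>\<^bsub>B\<^esub> f y) \<and>
     (\<forall>c\<in>carrier k. \<forall>x\<in>carrier A. f (c \<odot>\<^bsub>A\<^esub> x) = c \<odot>\<^bsub>B\<^esub> f x) \<and>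
     (\<forall>x\<in>carrier A. \<forall>y\<in>carrier A. f (x \<otimes>\<^bsub>A\<^esub> y) = f x \<otimes>\<^bsub>B\<^esub> f y) \<and>
     (\<forall>x\<in>carrier A. f (rbop A x) = rbop B (f x))}"

definition unitary_rb_hom :: "('a, 'm) ring_scheme \<Rightarrow> ('a, 'b, 'c) rb_scheme
    \<Rightarrow> ('a, 'd, 'e) rb_scheme \<Rightarrow> ('b \<Rightarrow> 'd) set" where
  "unitary_rb_hom k A B = {f \<in> rb_hom k A B. f \<one>\<^bsub>A\<^esub> = \<one>\<^bsub>B\<^esub>}"

text \<open>
  HOL cannot quantify over types inside a formula, so the type \<open>'t\<close> in which the test algebras \<open>B\<close>
  live is a parameter; a theorem about \<open>is_unitarization TYPE('t)\<close> with \<open>'t\<close> a type variable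
  covers test algebras of every type.
\<close>

definition is_unitarization :: "'t itself \<Rightarrow> ('a, 'm) ring_scheme \<Rightarrow> 'a \<Rightarrow> ('a, 'b, 'c) rb_scheme
    \<Rightarrow> ('a, 'd, 'e) rb_scheme \<Rightarrow> ('b \<Rightarrow> 'd) \<Rightarrow> bool" where
  "is_unitarization _ k lam A A' u \<longleftrightarrow>
     rota_baxter k lam A \<and> unitary_rota_baxter k lam A' \<and> u \<in> rb_hom k A A' \<and>
     (\<forall>B :: ('a, 't) rb. unitary_rota_baxter k lam B \<longrightarrow>
        (\<forall>f\<in>rb_hom k A B.
           \<exists>!g. g \<in> unitary_rb_hom k A' B \<and> (\<forall>a\<in>carrier A. f a = g (u a))))"


section \<open>Planar rooted trees and forests\<close>

text \<open>
  \<open>Br [T\<^sub>1, \<dots>, T\<^sub>b]\<close> has root children \<open>T\<^sub>1, \<dots>, T\<^sub>b\<close>; thus \<open>Br []\<close> is the one-vertex tree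
  and \<open>Br F\<close> with \<open>F \<noteq> []\<close> is the bracket of the forest \<open>F\<close>. Forests are nonempty lists of trees,
  with concatenation as the free semigroup product.
\<close>

datatype ptree = Br "ptree list"

type_synonym pforest = "ptree list"

abbreviation dot :: ptree where
  "dot \<equiv> Br []"

definition forests :: "pforest set" where
  "forests = {F. F \<noteq> []}"

fun tree_leaves :: "ptree \<Rightarrow> nat" where
  "tree_leaves (Br ts) = (if ts = [] then 1 else sum_list (map tree_leaves ts))"

definition leaves :: "pforest \<Rightarrow> nat" where
  "leaves F = sum_list (map tree_leaves F)"

fun subtrees :: "ptree \<Rightarrow> ptree set" where
  "subtrees (Br ts) = insert (Br ts) (\<Union>t\<in>set ts. subtrees t)"

definition forests0 :: "pforest set" where
  "forests0 = {F \<in> forests. F \<noteq> [dot] \<and> (\<forall>T\<in>set F. Br [dot] \<notin> subtrees T)}"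


section \<open>Free modules\<close>

text \<open>Elements are the finitely supported coefficient functions on the basis \<open>S\<close>.\<close>

definition free_carrier :: "('a, 'm) ring_scheme \<Rightarrow> 's set \<Rightarrow> ('s \<Rightarrow> 'a) set" where
  "free_carrier k S = {a. (\<forall>s. a s \<in> carrier k) \<and> {s. a s \<noteq> \<zero>\<^bsub>k\<^esub>} \<subseteq> S \<and> finite {s. a s \<noteq> \<zero>\<^bsub>k\<^esub>}}"

definition fzero :: "('a, 'm) ring_scheme \<Rightarrow> 's \<Rightarrow> 'a" where
  "fzero k = (\<lambda>_. \<zero>\<^bsub>k\<^esub>)"

definition fadd :: "('a, 'm) ring_scheme \<Rightarrow> ('s \<Rightarrow> 'a) \<Rightarrow> ('s \<Rightarrow> 'a) \<Rightarrow> 's \<Rightarrow> 'a" where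
  "fadd k a b = (\<lambda>s. a s \<oplus>\<^bsub>k\<^esub> b s)"

definition fsmult :: "('a, 'm) ring_scheme \<Rightarrow> 'a \<Rightarrow> ('s \<Rightarrow> 'a) \<Rightarrow> 's \<Rightarrow> 'a" where
  "fsmult k c a = (\<lambda>s. c \<otimes>\<^bsub>k\<^esub> a s)"

definition basis :: "('a, 'm) ring_scheme \<Rightarrow> 's \<Rightarrow> 's \<Rightarrow> 'a" where
  "basis k s = (\<lambda>t. if t = s then \<one>\<^bsub>k\<^esub> else \<zero>\<^bsub>k\<^esub>)"

text \<open>The linear extension of a map \<open>\<phi>\<close> from basis elements to another free module.\<close>

definition lin_ext :: "('a, 'm) ring_scheme \<Rightarrow> ('s \<Rightarrow> 't \<Rightarrow> 'a) \<Rightarrow> ('s \<Rightarrow> 'a) \<Rightarrow> 't \<Rightarrow> 'a" where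
  "lin_ext k \<phi> a = (\<lambda>t. finsum k (\<lambda>s. a s \<otimes>\<^bsub>k\<^esub> \<phi> s t) {s. a s \<noteq> \<zero>\<^bsub>k\<^esub>})"


section \<open>The product of forests\<close>

definition bracket :: "('a, 'm) ring_scheme \<Rightarrow> (pforest \<Rightarrow> 'a) \<Rightarrow> pforest \<Rightarrow> 'a" where
  "bracket k = lin_ext k (\<lambda>F. basis k [Br F])"

text \<open>
  \<open>tree_prod\<close> is the product of two trees, a combination of one-tree forests, and \<open>forest_prod\<close>
  the product of two forests. The empty list is not a forest; the value there is irrelevant.
\<close>

function (sequential)
  tree_prod :: "('a, 'm) ring_scheme \<Rightarrow> 'a \<Rightarrow> ptree \<Rightarrow> ptree \<Rightarrow> pforest \<Rightarrow> 'a" and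
  forest_prod :: "('a, 'm) ring_scheme \<Rightarrow> 'a \<Rightarrow> pforest \<Rightarrow> pforest \<Rightarrow> pforest \<Rightarrow> 'a" where
  "tree_prod k lam T (Br []) = basis k [T]"
| "tree_prod k lam (Br []) T' = basis k [T']"
| "tree_prod k lam (Br F) (Br F') =
     fadd k (fadd k
       (bracket k (forest_prod k lam [Br F] F'))
       (bracket k (forest_prod k lam F [Br F'])))
       (fsmult k lam (bracket k (forest_prod k lam F F')))"
| "forest_prod k lam F F' =
     (if F = [] \<or> F' = [] then fzero k
      else lin_ext k (\<lambda>G. basis k (butlast F @ G @ tl F'))
             (tree_prod k lam (last F) (hd F')))"
  by pat_completeness auto

lemma size_last_le: "F \<noteq> [] \<Longrightarrow> size (last F) \<le> sum_list (map size F)"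
  by (induction F) auto

lemma size_hd_le: "F \<noteq> [] \<Longrightarrow> size (hd F) \<le> sum_list (map size F)"
  by (cases F) auto

lemma size_Br: "size (Br F) = Suc (sum_list (map size F) + length F)"
  by (induction F) auto

termination
  apply (relation "measure (\<lambda>x. case x of
      Inl (_, _, T, T') \<Rightarrow> 2 * (size T + size T')
    | Inr (_, _, F, F') \<Rightarrow> 2 * (sum_list (map size F) + sum_list (map size F')) + 1)")
  apply (rule wf_measure)
  apply (simp_all del: ptree.size add: size_Br)
  subgoal for F F' using size_last_le[of F] size_hd_le[of F'] by linarith
  done


section \<open>The algebras of decorated forests\<close>

type_synonym 'x decorated = "pforest \<times> 'x list"

definition decorated_forests :: "'x set \<Rightarrow> 'x decorated set" where
  "decorated_forests X = {(F, xs). F \<in> forests \<and> xs \<in> lists X \<and> length xs = leaves F - 1}"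

definition sh_mult :: "('a, 'm) ring_scheme \<Rightarrow> 'a \<Rightarrow> ('x decorated \<Rightarrow> 'a) \<Rightarrow> ('x decorated \<Rightarrow> 'a)
    \<Rightarrow> 'x decorated \<Rightarrow> 'a" where
  "sh_mult k lam a b =
     lin_ext k (\<lambda>(F, xs).
       lin_ext k (\<lambda>(F', xs').
         lin_ext k (\<lambda>G. basis k (G, xs @ xs')) (forest_prod k lam F F')) b) a"

definition sh_op :: "('a, 'm) ring_scheme \<Rightarrow> ('x decorated \<Rightarrow> 'a) \<Rightarrow> 'x decorated \<Rightarrow> 'a" where
  "sh_op k = lin_ext k (\<lambda>(F, xs). basis k ([Br F], xs))"

definition Sh_NC :: "('a, 'm) ring_scheme \<Rightarrow> 'a \<Rightarrow> 'x set \<Rightarrow> ('a, 'x decorated \<Rightarrow> 'a) rb" where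
  "Sh_NC k lam X =
     \<lparr>carrier = free_carrier k (decorated_forests X),
      mult = sh_mult k lam,
      one = basis k ([dot], []),
      zero = fzero k,
      add = fadd k,
      smult = fsmult k,
      rbop = sh_op k\<rparr>"

definition j_NC :: "('a, 'm) ring_scheme \<Rightarrow> 'x \<Rightarrow> 'x decorated \<Rightarrow> 'a" where
  "j_NC k x = basis k ([dot, dot], [x])"

text \<open>
  The span of the decorated forests with underlying forest in \<^const>\<open>forests0\<close>. The inherited field
  \<^const>\<open>one\<close> plays no role.
\<close>

definition Sh_NC0 :: "('a, 'm) ring_scheme \<Rightarrow> 'a \<Rightarrow> 'x set \<Rightarrow> ('a, 'x decorated \<Rightarrow> 'a) rb" where
  "Sh_NC0 k lam X =
     (Sh_NC k lam X)\<lparr>carrier := free_carrier k {(F, xs) \<in> decorated_forests X. F \<in> forests0}\<rparr>"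

definition j_NC0 :: "('a, 'm) ring_scheme \<Rightarrow> 'x \<Rightarrow> 'x decorated \<Rightarrow> 'a" where
  "j_NC0 k x = basis k ([dot, dot], [x])"

definition is_u_NC :: "('a, 'm) ring_scheme \<Rightarrow> 'a \<Rightarrow> 'x set
    \<Rightarrow> (('x decorated \<Rightarrow> 'a) \<Rightarrow> ('x decorated \<Rightarrow> 'a)) \<Rightarrow> bool" where
  "is_u_NC k lam X u \<longleftrightarrow>
     u \<in> rb_hom k (Sh_NC0 k lam X) (Sh_NC k lam X) \<and> (\<forall>x\<in>X. j_NC k x = u (j_NC0 k x))"

definition u_NC :: "('a, 'm) ring_scheme \<Rightarrow> 'a \<Rightarrow> 'x set
    \<Rightarrow> ('x decorated \<Rightarrow> 'a) \<Rightarrow> ('x decorated \<Rightarrow> 'a)" where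
  "u_NC k lam X = (THE u. is_u_NC k lam X u)"

end

theory Submission
  imports Defs
begin

text \<open>
  Both algebras live inside the same combinatorics, and the map \<open>u\<close> turns out to be the inclusion.
  The statement then rests on two facts about decorated forests.

  First, every decorated forest is produced from the generators \<open>(\<bullet>\<squnion>\<bullet>; x)\<close>. A tree other than
  \<open>\<bullet>\<close> is the operator applied to a smaller forest, and \<open>(F\<squnion>G; xs, x, ys)\<close> is the product of
  \<open>(F; xs)\<close>, \<open>(\<bullet>\<squnion>\<bullet>; x)\<close> and \<open>(G; ys)\<close>. The only factor that is not itself produced from
  generators is \<open>\<bullet>\<close>, the identity. In \<open>Sh\<^sup>N\<^sup>C\<^sup>,\<^sup>0\<close>, where \<open>\<bullet>\<close> is not available, this factor can simply be
  omitted, since no bracket \<open>\<lfloor>\<bullet>\<rfloor>\<close> occurs. Hence a homomorphism out of either algebra, preserving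
  the identity in the unitary case, is determined by its values on the generators (\<open>rb_hom_eqI\<close>); this yields uniqueness of \<open>u\<close> and of the extension \<open>g\<close>.

  Secondly, the same decomposition lets every decorated forest be evaluated in a unitary algebra \<open>B\<close>,
  once elements of \<open>B\<close> are chosen for the letters. The choice \<open>x \<mapsto> f (j x)\<close> gives the required
  extension \<open>g\<close> of a homomorphism \<open>f\<close>: it agrees with \<open>f\<close> on generators, hence everywhere on
  \<open>Sh\<^sup>N\<^sup>C\<^sup>,\<^sup>0\<close>. That evaluation is multiplicative (\<open>ev_product\<close>) follows the recursion of the forest
  product, the bracket case being the Rota--Baxter identity of \<open>B\<close>.

  It also has to be shown that these forest algebras are Rota--Baxter algebras. The substance is associativity
  of the forest product (\<open>fmul_assoc_basis\<close>). Concatenation slides out of a product on either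
  side (\<open>fcat_fmul\<close>, \<open>fmul_fcat\<close>), which reduces the claim to three trees; three brackets are then
  handled by induction on size, both sides expanding through the Rota--Baxter identity into the same seven
  terms (\<open>rota_baxter_assoc_step\<close>). Decorations are carried along by concatenation and transfer
  the laws from forests to decorated forests (\<open>sh_mult_dec\<close>, \<open>sh_op_dec\<close>).

  Throughout, multilinear identities are checked on basis elements only (\<open>linear_eqI\<close>,
  \<open>bilinear_eqI\<close>, \<open>trilinear_assoc_eqI\<close>).
\<close>


section \<open>Linear and bilinear maps out of free modules\<close>

text \<open>
  Packaging the pointwise operations as a module makes linear maps between free modules and linear maps
  into a Rota--Baxter algebra instances of one notion.
\<close>

definition free_module :: "('a, 'm) ring_scheme \<Rightarrow> 's set \<Rightarrow> ('a, 's \<Rightarrow> 'a) module" where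
  "free_module k S = \<lparr>carrier = free_carrier k S, mult = (\<lambda>a b. a), one = fzero k,
     zero = fzero k, add = fadd k, smult = fsmult k\<rparr>"

lemma free_module_simps [simp]:
  "carrier (free_module k S) = free_carrier k S" "zero (free_module k S) = fzero k"
  "add (free_module k S) = fadd k" "smult (free_module k S) = fsmult k"
  by (simp_all add: free_module_def)

lemma free_operations_apply:
  "fzero k s = \<zero>\<^bsub>k\<^esub>" "fadd k a b s = a s \<oplus>\<^bsub>k\<^esub> b s" "fsmult k c a s = c \<otimes>\<^bsub>k\<^esub> a s"
  by (simp_all add: fzero_def fadd_def fsmult_def)

text \<open>
  The counterpart of \<^const>\<open>lin_ext\<close> for values in an arbitrary module, which is what evaluation in
  a Rota--Baxter algebra requires.
\<close>

definition lift :: "('a, 'm) ring_scheme \<Rightarrow> ('a, 'b, 'c) module_scheme \<Rightarrow> ('s \<Rightarrow> 'b) \<Rightarrow> ('s \<Rightarrow> 'a) \<Rightarrow> 'b" where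
  "lift k M \<phi> a = finsum M (\<lambda>s. a s \<odot>\<^bsub>M\<^esub> \<phi> s) {s. a s \<noteq> \<zero>\<^bsub>k\<^esub>}"

text \<open>
  Linearity is relative to a set \<open>S\<close> of basis elements, because products and evaluations of forests are
  well behaved only on spans of forests of suitable shape and number of leaves.
\<close>

definition linear_on :: "('a, 'm) ring_scheme \<Rightarrow> 's set \<Rightarrow> ('a, 'b, 'c) module_scheme
    \<Rightarrow> (('s \<Rightarrow> 'a) \<Rightarrow> 'b) \<Rightarrow> bool" where
  "linear_on k S M f \<longleftrightarrow>
     (\<forall>a\<in>free_carrier k S. f a \<in> carrier M) \<and>
     (\<forall>a\<in>free_carrier k S. \<forall>b\<in>free_carrier k S. f (fadd k a b) = f a \<oplus>\<^bsub>M\<^esub> f b) \<and>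
     (\<forall>c\<in>carrier k. \<forall>a\<in>free_carrier k S. f (fsmult k c a) = c \<odot>\<^bsub>M\<^esub> f a)"

definition bilinear_on :: "('a, 'm) ring_scheme \<Rightarrow> 's set \<Rightarrow> 't set \<Rightarrow> ('a, 'b, 'c) module_scheme
    \<Rightarrow> (('s \<Rightarrow> 'a) \<Rightarrow> ('t \<Rightarrow> 'a) \<Rightarrow> 'b) \<Rightarrow> bool" where
  "bilinear_on k S T M f \<longleftrightarrow>
     (\<forall>b\<in>free_carrier k T. linear_on k S M (\<lambda>a. f a b)) \<and>
     (\<forall>a\<in>free_carrier k S. linear_on k T M (f a))"

definition bilin_ext :: "('a, 'm) ring_scheme \<Rightarrow> ('s \<Rightarrow> 't \<Rightarrow> 'u \<Rightarrow> 'a)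
    \<Rightarrow> ('s \<Rightarrow> 'a) \<Rightarrow> ('t \<Rightarrow> 'a) \<Rightarrow> 'u \<Rightarrow> 'a" where
  "bilin_ext k \<phi> a b = lin_ext k (\<lambda>s. lin_ext k (\<phi> s) b) a"

lemma linear_onD:
  assumes "linear_on k S M f"
  shows "a \<in> free_carrier k S \<Longrightarrow> f a \<in> carrier M"
    and "\<lbrakk>a \<in> free_carrier k S; b \<in> free_carrier k S\<rbrakk> \<Longrightarrow> f (fadd k a b) = f a \<oplus>\<^bsub>M\<^esub> f b"
    and "\<lbrakk>c \<in> carrier k; a \<in> free_carrier k S\<rbrakk> \<Longrightarrow> f (fsmult k c a) = c \<odot>\<^bsub>M\<^esub> f a"
  using assms by (auto simp: linear_on_def)

lemma bilinear_onD:
  assumes "bilinear_on k S T M f"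
  shows "\<lbrakk>a \<in> free_carrier k S; b \<in> free_carrier k T\<rbrakk> \<Longrightarrow> f a b \<in> carrier M"
    and "\<lbrakk>a \<in> free_carrier k S; a' \<in> free_carrier k S; b \<in> free_carrier k T\<rbrakk>
      \<Longrightarrow> f (fadd k a a') b = f a b \<oplus>\<^bsub>M\<^esub> f a' b"
    and "\<lbrakk>a \<in> free_carrier k S; b \<in> free_carrier k T; b' \<in> free_carrier k T\<rbrakk>
      \<Longrightarrow> f a (fadd k b b') = f a b \<oplus>\<^bsub>M\<^esub> f a b'"
    and "\<lbrakk>c \<in> carrier k; a \<in> free_carrier k S; b \<in> free_carrier k T\<rbrakk>
      \<Longrightarrow> f (fsmult k c a) b = c \<odot>\<^bsub>M\<^esub> f a b"
    and "\<lbrakk>c \<in> carrier k; a \<in> free_carrier k S; b \<in> free_carrier k T\<rbrakk>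
      \<Longrightarrow> f a (fsmult k c b) = c \<odot>\<^bsub>M\<^esub> f a b"
  using assms by (auto simp: bilinear_on_def linear_on_def)

lemma bilinear_on_linear:
  assumes "bilinear_on k S T M f"
  shows "b \<in> free_carrier k T \<Longrightarrow> linear_on k S M (\<lambda>a. f a b)"
    and "a \<in> free_carrier k S \<Longrightarrow> linear_on k T M (f a)"
  using assms by (auto simp: bilinear_on_def)

lemma linear_on_compose:
  "\<lbrakk>linear_on k S (free_module k T) f; linear_on k T M g\<rbrakk> \<Longrightarrow> linear_on k S M (\<lambda>a. g (f a))"
  by (simp add: linear_on_def)

lemma bilinear_on_compose:
  "\<lbrakk>bilinear_on k S T (free_module k U) f; linear_on k U M g\<rbrakk>
    \<Longrightarrow> bilinear_on k S T M (\<lambda>a b. g (f a b))"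
  by (simp add: bilinear_on_def linear_on_def)

lemma bilinear_on_compose2:
  "\<lbrakk>bilinear_on k S' T' M m; linear_on k S (free_module k S') f; linear_on k T (free_module k T') g\<rbrakk>
    \<Longrightarrow> bilinear_on k S T M (\<lambda>a b. m (f a) (g b))"
  by (simp add: bilinear_on_def linear_on_def)

lemma linear_on_id: "S \<subseteq> T \<Longrightarrow> linear_on k S (free_module k T) (\<lambda>a. a)"
  by (auto simp: linear_on_def free_carrier_def)

lemma free_carrier_mono: "S \<subseteq> T \<Longrightarrow> free_carrier k S \<subseteq> free_carrier k T"
  by (auto simp: free_carrier_def)

context cring
begin

lemma free_carrier_val: "a \<in> free_carrier R S \<Longrightarrow> a s \<in> carrier R"
  by (simp add: free_carrier_def)

lemma fzero_closed [simp, intro]: "fzero R \<in> free_carrier R S"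
  by (simp add: free_carrier_def fzero_def)

lemma fadd_closed [simp, intro]:
  assumes "a \<in> free_carrier R S" "b \<in> free_carrier R S"
  shows "fadd R a b \<in> free_carrier R S"
proof -
  have sub: "{s. fadd R a b s \<noteq> \<zero>} \<subseteq> {s. a s \<noteq> \<zero>} \<union> {s. b s \<noteq> \<zero>}"
    by (auto simp: fadd_def)
  moreover have "finite ({s. a s \<noteq> \<zero>} \<union> {s. b s \<noteq> \<zero>})"
    using assms by (auto simp: free_carrier_def)
  ultimately have "finite {s. fadd R a b s \<noteq> \<zero>}" by (rule finite_subset)
  moreover have "{s. fadd R a b s \<noteq> \<zero>} \<subseteq> S"
    using sub assms by (force simp: free_carrier_def)
  ultimately show ?thesis using assms by (auto simp: free_carrier_def fadd_def)
qed

lemma fsmult_closed [simp, intro]: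
  assumes "c \<in> carrier R" "a \<in> free_carrier R S"
  shows "fsmult R c a \<in> free_carrier R S"
proof -
  have sub: "{s. fsmult R c a s \<noteq> \<zero>} \<subseteq> {s. a s \<noteq> \<zero>}"
    using assms by (auto simp: fsmult_def)
  moreover have "finite {s. a s \<noteq> \<zero>}"
    using assms by (auto simp: free_carrier_def)
  ultimately have "finite {s. fsmult R c a s \<noteq> \<zero>}" by (rule finite_subset)
  moreover have "{s. fsmult R c a s \<noteq> \<zero>} \<subseteq> S"
    using sub assms by (force simp: free_carrier_def)
  ultimately show ?thesis using assms by (auto simp: free_carrier_def fsmult_def)
qed

lemma basis_closed [simp, intro]:
  assumes "s \<in> S" shows "basis R s \<in> free_carrier R S"
proof -
  have "{t. basis R s t \<noteq> \<zero>} \<subseteq> {s}" by (auto simp: basis_def)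
  then show ?thesis
    using assms finite_subset by (fastforce simp: free_carrier_def basis_def)
qed

lemma module_of_free_carrier:
  assumes [simp]: "carrier M = free_carrier R S" "zero M = fzero R" "add M = fadd R" "smult M = fsmult R"
  shows "module R M"
proof (rule moduleI)
  show "cring R" ..
  show "abelian_group M"
  proof (rule abelian_groupI)
    fix a assume a: "a \<in> carrier M"
    show "\<exists>b\<in>carrier M. b \<oplus>\<^bsub>M\<^esub> a = \<zero>\<^bsub>M\<^esub>"
    proof (rule bexI[of _ "fsmult R (\<ominus> \<one>) a"])
      show "fsmult R (\<ominus> \<one>) a \<oplus>\<^bsub>M\<^esub> a = \<zero>\<^bsub>M\<^esub>"
        using a by (auto simp: free_operations_apply fun_eq_iff l_minus l_neg free_carrier_val)
    qed (use a in auto)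
  qed (auto simp: free_operations_apply fun_eq_iff a_ac free_carrier_val)
qed (auto simp: free_operations_apply fun_eq_iff l_distr r_distr m_assoc free_carrier_val)

lemma module_free_module: "module R (free_module R S)"
  by (rule module_of_free_carrier) simp_all

text \<open>
  The sum defining \<^const>\<open>lift\<close> ranges over the support, which changes with the argument; additivity
  needs one index set that serves two arguments and their sum.
\<close>

lemma lift_superset:
  assumes M: "module R M" and a: "a \<in> free_carrier R S" and \<phi>: "\<And>s. s \<in> A \<Longrightarrow> \<phi> s \<in> carrier M"
    and A: "finite A" "{s. a s \<noteq> \<zero>} \<subseteq> A"
  shows "lift R M \<phi> a = finsum M (\<lambda>s. a s \<odot>\<^bsub>M\<^esub> \<phi> s) A"
proof -
  interpret M: "module" R M by fact
  show ?thesis unfolding lift_def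
    by (rule M.add.finprod_mono_neutral_cong_left)
       (use A a \<phi> in \<open>auto simp: free_carrier_val\<close>)
qed

lemma lift_linear:
  assumes M: "module R M" and \<phi>: "\<And>s. s \<in> S \<Longrightarrow> \<phi> s \<in> carrier M"
  shows "linear_on R S M (lift R M \<phi>)"
proof -
  interpret M: "module" R M by fact
  have fin: "finite {s. a s \<noteq> \<zero>}" "{s. a s \<noteq> \<zero>} \<subseteq> S" if "a \<in> free_carrier R S" for a
    using that by (auto simp: free_carrier_def)
  have "lift R M \<phi> (fadd R a b) = lift R M \<phi> a \<oplus>\<^bsub>M\<^esub> lift R M \<phi> b"
    if a: "a \<in> free_carrier R S" and b: "b \<in> free_carrier R S" for a b
  proof -
    let ?A = "{s. a s \<noteq> \<zero>} \<union> {s. b s \<noteq> \<zero>}"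
    have A: "finite ?A" "?A \<subseteq> S" using fin a b by auto
    have \<phi>': "s \<in> ?A \<Longrightarrow> \<phi> s \<in> carrier M" for s using A \<phi> by blast
    note sup = lift_superset[OF M _ \<phi>' A(1), where S = S]
    have "lift R M \<phi> (fadd R a b) = finsum M (\<lambda>s. fadd R a b s \<odot>\<^bsub>M\<^esub> \<phi> s) ?A"
      by (rule sup) (use a b in \<open>auto simp: free_operations_apply\<close>)
    also have "\<dots> = finsum M (\<lambda>s. a s \<odot>\<^bsub>M\<^esub> \<phi> s \<oplus>\<^bsub>M\<^esub> b s \<odot>\<^bsub>M\<^esub> \<phi> s) ?A"
      by (rule M.finsum_cong')
         (use a b \<phi>' in \<open>auto simp: free_operations_apply M.smult_l_distr free_carrier_val\<close>)
    also have "\<dots> = finsum M (\<lambda>s. a s \<odot>\<^bsub>M\<^esub> \<phi> s) ?A \<oplus>\<^bsub>M\<^esub> finsum M (\<lambda>s. b s \<odot>\<^bsub>M\<^esub> \<phi> s) ?A"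
      by (rule M.finsum_addf) (use a b \<phi>' in \<open>auto simp: free_carrier_val\<close>)
    also have "\<dots> = lift R M \<phi> a \<oplus>\<^bsub>M\<^esub> lift R M \<phi> b"
      using sup[OF a] sup[OF b] by simp
    finally show ?thesis .
  qed
  moreover have "lift R M \<phi> (fsmult R c a) = c \<odot>\<^bsub>M\<^esub> lift R M \<phi> a"
    if c: "c \<in> carrier R" and a: "a \<in> free_carrier R S" for c a
  proof -
    let ?A = "{s. a s \<noteq> \<zero>}"
    have \<phi>': "s \<in> ?A \<Longrightarrow> \<phi> s \<in> carrier M" for s using fin[OF a] \<phi> by blast
    have "lift R M \<phi> (fsmult R c a) = finsum M (\<lambda>s. fsmult R c a s \<odot>\<^bsub>M\<^esub> \<phi> s) ?A"
      by (rule lift_superset[OF M fsmult_closed[OF c a] \<phi>']) (use fin[OF a] c in \<open>auto simp: fsmult_def\<close>)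
    also have "\<dots> = finsum M (\<lambda>s. c \<odot>\<^bsub>M\<^esub> (a s \<odot>\<^bsub>M\<^esub> \<phi> s)) ?A"
      by (rule M.finsum_cong')
         (use c a \<phi>' in \<open>auto simp: fsmult_def M.smult_assoc1 free_carrier_val\<close>)
    also have "\<dots> = c \<odot>\<^bsub>M\<^esub> lift R M \<phi> a" unfolding lift_def
      by (rule M.finsum_smult_ldistr[symmetric]) (use c a \<phi>' fin[OF a] in \<open>auto simp: free_carrier_val\<close>)
    finally show ?thesis .
  qed
  moreover have "lift R M \<phi> a \<in> carrier M" if a: "a \<in> free_carrier R S" for a
    unfolding lift_def by (rule M.finsum_closed) (use a \<phi> fin[OF a] in \<open>auto simp: free_carrier_val\<close>)
  ultimately show ?thesis by (simp add: linear_on_def)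
qed

lemma lift_basis:
  assumes M: "module R M" and \<phi>: "\<phi> s \<in> carrier M"
  shows "lift R M \<phi> (basis R s) = \<phi> s"
proof -
  interpret M: "module" R M by fact
  have "lift R M \<phi> (basis R s) = finsum M (\<lambda>t. basis R s t \<odot>\<^bsub>M\<^esub> \<phi> t) {s}"
    by (rule lift_superset[OF M basis_closed[of s "{s}"]]) (use \<phi> in \<open>auto simp: basis_def\<close>)
  then show ?thesis using \<phi> by (simp add: M.finsum_insert basis_def)
qed

text \<open>
  Sums in a free module are taken coordinatewise; this identifies \<^const>\<open>lin_ext\<close> with
  \<^const>\<open>lift\<close>, so that linearity has to be proved for \<^const>\<open>lift\<close> only.
\<close>

lemma finsum_free_module:
  assumes "finite A" "g \<in> A \<rightarrow> free_carrier R T"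
  shows "finsum (free_module R T) g A t = (\<Oplus>s\<in>A. g s t)"
  using assms
proof (induction A rule: finite_induct)
  case empty
  interpret T: "module" R "free_module R T" by (rule module_free_module)
  show ?case by (simp add: free_operations_apply)
next
  case (insert s A)
  interpret T: "module" R "free_module R T" by (rule module_free_module)
  have "g s t \<in> carrier R" "(\<lambda>s. g s t) \<in> A \<rightarrow> carrier R" for t
    using insert.prems by (auto simp: Pi_iff free_carrier_val)
  with insert show ?case
    by (subst T.finsum_insert) (auto simp: free_operations_apply)
qed

lemma lin_ext_eq_lift:
  assumes a: "a \<in> free_carrier R S" and \<phi>: "\<And>s. s \<in> S \<Longrightarrow> \<phi> s \<in> free_carrier R T"
  shows "lin_ext R \<phi> a = lift R (free_module R T) \<phi> a"
proof
  fix t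
  have A: "finite {s. a s \<noteq> \<zero>}" "{s. a s \<noteq> \<zero>} \<subseteq> S"
    using a by (auto simp: free_carrier_def)
  show "lin_ext R \<phi> a t = lift R (free_module R T) \<phi> a t" unfolding lift_def lin_ext_def
    by (subst finsum_free_module[OF A(1)])
       (use A(2) a \<phi> in \<open>auto simp: free_operations_apply free_carrier_val intro!: fsmult_closed\<close>)
qed

lemma linear_on_cong:
  assumes "linear_on R S M f" "\<And>a. a \<in> free_carrier R S \<Longrightarrow> f a = g a"
  shows "linear_on R S M g"
  using assms by (simp add: linear_on_def)

lemma lin_ext_linear:
  assumes "\<And>s. s \<in> S \<Longrightarrow> \<phi> s \<in> free_carrier R T"
  shows "linear_on R S (free_module R T) (lin_ext R \<phi>)"
  by (rule linear_on_cong[OF lift_linear[OF module_free_module, of S \<phi>]])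
     (use assms lin_ext_eq_lift[of _ S \<phi> T] in auto)

lemma lin_ext_basis:
  assumes "\<phi> s \<in> free_carrier R T"
  shows "lin_ext R \<phi> (basis R s) = \<phi> s"
  using lift_basis[OF module_free_module, of \<phi> s T] lin_ext_eq_lift[of "basis R s" "{s}" \<phi> T] assms
  by simp

lemma lin_ext_cong:
  assumes "a \<in> free_carrier R S" "\<And>s. s \<in> S \<Longrightarrow> \<phi> s = \<psi> s" "\<And>s. s \<in> S \<Longrightarrow> \<psi> s \<in> free_carrier R T"
  shows "lin_ext R \<phi> a = lin_ext R \<psi> a"
  unfolding lin_ext_def fun_eq_iff
  by (intro allI finsum_cong' refl) (use assms in \<open>auto simp: free_carrier_def subset_iff\<close>)

text \<open>
  Linearity in the map that is extended, as opposed to the argument; it provides the linearity of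
  \<^const>\<open>bilin_ext\<close> in the second variable.
\<close>

lemma lin_ext_fadd:
  assumes "a \<in> free_carrier R S" "\<And>s. s \<in> S \<Longrightarrow> \<phi> s \<in> free_carrier R T"
    "\<And>s. s \<in> S \<Longrightarrow> \<psi> s \<in> free_carrier R T"
  shows "lin_ext R (\<lambda>s. fadd R (\<phi> s) (\<psi> s)) a = fadd R (lin_ext R \<phi> a) (lin_ext R \<psi> a)"
proof
  fix t
  have A: "a s \<in> carrier R" "a s \<noteq> \<zero> \<Longrightarrow> \<phi> s t \<in> carrier R" "a s \<noteq> \<zero> \<Longrightarrow> \<psi> s t \<in> carrier R" for s
    using assms by (auto simp: free_carrier_def subset_iff)
  then have "lin_ext R (\<lambda>s. fadd R (\<phi> s) (\<psi> s)) a t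
      = (\<Oplus>s\<in>{s. a s \<noteq> \<zero>}. a s \<otimes> \<phi> s t \<oplus> a s \<otimes> \<psi> s t)"
    unfolding lin_ext_def by (intro finsum_cong') (auto simp: fadd_def r_distr)
  also have "\<dots> = fadd R (lin_ext R \<phi> a) (lin_ext R \<psi> a) t"
    unfolding lin_ext_def fadd_def by (rule finsum_addf) (use A in auto)
  finally show "lin_ext R (\<lambda>s. fadd R (\<phi> s) (\<psi> s)) a t = fadd R (lin_ext R \<phi> a) (lin_ext R \<psi> a) t" .
qed

lemma lin_ext_fsmult:
  assumes "a \<in> free_carrier R S" "\<And>s. s \<in> S \<Longrightarrow> \<phi> s \<in> free_carrier R T" "c \<in> carrier R"
  shows "lin_ext R (\<lambda>s. fsmult R c (\<phi> s)) a = fsmult R c (lin_ext R \<phi> a)"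
proof
  fix t
  have A: "a s \<in> carrier R" "a s \<noteq> \<zero> \<Longrightarrow> \<phi> s t \<in> carrier R" "finite {s. a s \<noteq> \<zero>}" for s
    using assms by (auto simp: free_carrier_def subset_iff)
  then have "lin_ext R (\<lambda>s. fsmult R c (\<phi> s)) a t
      = (\<Oplus>s\<in>{s. a s \<noteq> \<zero>}. c \<otimes> (a s \<otimes> \<phi> s t))"
    unfolding lin_ext_def by (intro finsum_cong') (use assms(3) in \<open>auto simp: fsmult_def m_lcomm\<close>)
  also have "\<dots> = fsmult R c (lin_ext R \<phi> a) t"
    unfolding lin_ext_def fsmult_def by (rule finsum_rdistr[symmetric]) (use A assms(3) in auto)
  finally show "lin_ext R (\<lambda>s. fsmult R c (\<phi> s)) a t = fsmult R c (lin_ext R \<phi> a) t" .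
qed

lemma bilin_ext_bilinear:
  assumes \<phi>: "\<And>s t. \<lbrakk>s \<in> S; t \<in> T\<rbrakk> \<Longrightarrow> \<phi> s t \<in> free_carrier R U"
  shows "bilinear_on R S T (free_module R U) (bilin_ext R \<phi>)"
proof -
  have inner: "linear_on R T (free_module R U) (lin_ext R (\<phi> s))" if "s \<in> S" for s
    by (rule lin_ext_linear) (use that \<phi> in auto)
  note D = linear_onD[OF inner, simplified]
  have outer: "linear_on R S (free_module R U) (lin_ext R (\<lambda>s. lin_ext R (\<phi> s) b))"
    if "b \<in> free_carrier R T" for b
    by (rule lin_ext_linear) (use that D in auto)
  have "linear_on R T (free_module R U) (\<lambda>b. lin_ext R (\<lambda>s. lin_ext R (\<phi> s) b) a)"
    if a: "a \<in> free_carrier R S" for a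
    unfolding linear_on_def
  proof (intro conjI ballI)
    fix b b' assume b: "b \<in> free_carrier R T" and b': "b' \<in> free_carrier R T"
    have "lin_ext R (\<lambda>s. lin_ext R (\<phi> s) (fadd R b b')) a =
       lin_ext R (\<lambda>s. fadd R (lin_ext R (\<phi> s) b) (lin_ext R (\<phi> s) b')) a"
      by (rule lin_ext_cong[OF a]) (use D b b' in auto)
    also have "\<dots> = fadd R (lin_ext R (\<lambda>s. lin_ext R (\<phi> s) b) a) (lin_ext R (\<lambda>s. lin_ext R (\<phi> s) b') a)"
      by (rule lin_ext_fadd[OF a]) (use D b b' in auto)
    finally show "lin_ext R (\<lambda>s. lin_ext R (\<phi> s) (fadd R b b')) a =
       lin_ext R (\<lambda>s. lin_ext R (\<phi> s) b) a \<oplus>\<^bsub>free_module R U\<^esub> lin_ext R (\<lambda>s. lin_ext R (\<phi> s) b') a"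
      by simp
  next
    fix c b assume c: "c \<in> carrier R" and b: "b \<in> free_carrier R T"
    have "lin_ext R (\<lambda>s. lin_ext R (\<phi> s) (fsmult R c b)) a =
       lin_ext R (\<lambda>s. fsmult R c (lin_ext R (\<phi> s) b)) a"
      by (rule lin_ext_cong[OF a]) (use D c b in auto)
    also have "\<dots> = fsmult R c (lin_ext R (\<lambda>s. lin_ext R (\<phi> s) b) a)"
      by (rule lin_ext_fsmult[OF a]) (use D c b in auto)
    finally show "lin_ext R (\<lambda>s. lin_ext R (\<phi> s) (fsmult R c b)) a =
       c \<odot>\<^bsub>free_module R U\<^esub> lin_ext R (\<lambda>s. lin_ext R (\<phi> s) b) a"
      by simp
  qed (use linear_onD(1)[OF outer a] in auto)
  with outer show ?thesis by (simp add: bilinear_on_def bilin_ext_def[abs_def])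
qed

lemma bilin_ext_basis:
  assumes "\<phi> s t \<in> free_carrier R U"
  shows "bilin_ext R \<phi> (basis R s) (basis R t) = \<phi> s t"
  using assms lin_ext_basis[of "\<phi> s" t U] lin_ext_basis[of "\<lambda>s. lin_ext R (\<phi> s) (basis R t)" s U]
  by (simp add: bilin_ext_def)

text \<open>
  Peeling off one point of the support at a time writes any element as a combination of basis
  elements.
\<close>

lemma linear_eqI:
  assumes M: "module R M" and f: "linear_on R S M f" and g: "linear_on R S M g"
    and eq: "\<And>s. s \<in> S \<Longrightarrow> f (basis R s) = g (basis R s)" and a: "a \<in> free_carrier R S"
  shows "f a = g a"
proof -
  have "\<forall>a\<in>free_carrier R S. {s. a s \<noteq> \<zero>} \<subseteq> A \<longrightarrow> f a = g a" if "finite A" for A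
    using that
  proof (induction A rule: finite_induct)
    case empty
    have "f a = g a" if a: "a \<in> free_carrier R S" and "\<And>s. a s = \<zero>" for a
    proof -
      \<comment> \<open>The zero element is a multiple of itself by zero, so homogeneity alone forces its image.\<close>
      have eq: "a = fsmult R \<zero> a" using that by (auto simp: fsmult_def)
      have "f (fsmult R \<zero> a) = \<zero>\<^bsub>M\<^esub>" "g (fsmult R \<zero> a) = \<zero>\<^bsub>M\<^esub>"
        using module.smult_l_null[OF M] linear_onD(1,3)[OF f] linear_onD(1,3)[OF g] a by simp_all
      with eq show ?thesis by simp
    qed
    then show ?case by blast
  next
    case (insert s A)
    show ?case
    proof (intro ballI impI)
      fix a assume a: "a \<in> free_carrier R S" and sup: "{s. a s \<noteq> \<zero>} \<subseteq> insert s A"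
      show "f a = g a"
      proof (cases "a s = \<zero>")
        case True
        then show ?thesis using insert.IH a sup by auto
      next
        case False
        then have s: "s \<in> S" using a by (auto simp: free_carrier_def)
        let ?b = "a(s := \<zero>)"
        have "{t. ?b t \<noteq> \<zero>} \<subseteq> {t. a t \<noteq> \<zero>}" by auto
        with a have b: "?b \<in> free_carrier R S"
          unfolding free_carrier_def by (auto intro: finite_subset)
        have "{t. ?b t \<noteq> \<zero>} \<subseteq> A" using sup by auto
        with b have "f ?b = g ?b" using insert.IH by blast
        moreover have "a = fadd R ?b (fsmult R (a s) (basis R s))"
          using a by (auto simp: fadd_def fsmult_def basis_def free_carrier_val)
        moreover have "a s \<in> carrier R" using a by (rule free_carrier_val)
        ultimately show ?thesis using b s eq[OF s]
          linear_onD(2,3)[OF f] linear_onD(2,3)[OF g]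
          by (metis basis_closed fsmult_closed)
      qed
    qed
  qed
  then show ?thesis using a by (auto simp: free_carrier_def)
qed

lemma bilinear_eqI:
  assumes M: "module R M" and f: "bilinear_on R S T M f" and g: "bilinear_on R S T M g"
    and eq: "\<And>s t. \<lbrakk>s \<in> S; t \<in> T\<rbrakk> \<Longrightarrow> f (basis R s) (basis R t) = g (basis R s) (basis R t)"
    and a: "a \<in> free_carrier R S" and b: "b \<in> free_carrier R T"
  shows "f a b = g a b"
proof (rule linear_eqI[OF M, where f = "\<lambda>a. f a b" and g = "\<lambda>a. g a b", OF _ _ _ a])
  fix s assume "s \<in> S"
  then show "f (basis R s) b = g (basis R s) b"
    by (intro linear_eqI[OF M bilinear_on_linear(2)[OF f] bilinear_on_linear(2)[OF g] eq b]) auto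
qed (use bilinear_on_linear(1)[OF f b] bilinear_on_linear(1)[OF g b] in auto)

text \<open>
  Four possibly different operations are allowed, so that the lemma covers associativity as well as the laws
  by which concatenation slides out of a product.
\<close>

lemma trilinear_assoc_eqI:
  assumes f: "bilinear_on R S S (free_module R S) f" and g: "bilinear_on R S S (free_module R S) g"
    and f': "bilinear_on R S S (free_module R S) f'" and g': "bilinear_on R S S (free_module R S) g'"
    and eq: "\<And>s t u. \<lbrakk>s \<in> S; t \<in> S; u \<in> S\<rbrakk>
      \<Longrightarrow> f (g (basis R s) (basis R t)) (basis R u) = f' (basis R s) (g' (basis R t) (basis R u))"
    and a: "a \<in> free_carrier R S" and b: "b \<in> free_carrier R S" and c: "c \<in> free_carrier R S"
  shows "f (g a b) c = f' a (g' b c)"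
proof (rule linear_eqI[OF module_free_module, where f = "\<lambda>a. f (g a b) c" and g = "\<lambda>a. f' a (g' b c)"
      and S = S, OF _ _ _ a])
  show "linear_on R S (free_module R S) (\<lambda>a. f (g a b) c)"
    using linear_on_compose[OF bilinear_on_linear(1)[OF g b] bilinear_on_linear(1)[OF f c]] .
  show "linear_on R S (free_module R S) (\<lambda>a. f' a (g' b c))"
    by (rule bilinear_on_linear(1)[OF f']) (use bilinear_onD(1)[OF g' b c] in simp)
  fix s assume s: "s \<in> S"
  show "f (g (basis R s) b) c = f' (basis R s) (g' b c)"
  proof (rule bilinear_eqI[OF module_free_module _ _ _ b c,
        where f = "\<lambda>b c. f (g (basis R s) b) c" and g = "\<lambda>b c. f' (basis R s) (g' b c)"])
    show "bilinear_on R S S (free_module R S) (\<lambda>b. f (g (basis R s) b))"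
      using bilinear_on_compose2[OF f bilinear_on_linear(2)[OF g basis_closed[OF s]] linear_on_id] by simp
    show "bilinear_on R S S (free_module R S) (\<lambda>b c. f' (basis R s) (g' b c))"
      using bilinear_on_compose[OF g' bilinear_on_linear(2)[OF f' basis_closed[OF s]]] .
  qed (use s eq in auto)
qed

lemma bilinear_on_add:
  assumes M: "module R M" and f: "bilinear_on R S T M f" and g: "bilinear_on R S T M g"
  shows "bilinear_on R S T M (\<lambda>a b. f a b \<oplus>\<^bsub>M\<^esub> g a b)"
proof -
  interpret M: "module" R M by fact
  show ?thesis using bilinear_onD[OF f] bilinear_onD[OF g]
    by (auto simp: bilinear_on_def linear_on_def M.a_ac M.smult_r_distr)
qed

lemma bilinear_on_smult:
  assumes M: "module R M" and f: "bilinear_on R S T M f" and c: "c \<in> carrier R"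
  shows "bilinear_on R S T M (\<lambda>a b. c \<odot>\<^bsub>M\<^esub> f a b)"
proof -
  interpret M: "module" R M by fact
  show ?thesis using bilinear_onD[OF f] c
    by (auto simp: bilinear_on_def linear_on_def M.smult_r_distr m_comm simp flip: M.smult_assoc1)
qed

end


section \<open>Rota--Baxter identities on free modules\<close>

context cring
begin

lemma lin_ext_basis_id:
  assumes "a \<in> free_carrier R S"
  shows "lin_ext R (basis R) a = a"
  by (rule linear_eqI[OF module_free_module lin_ext_linear linear_on_id _ assms])
     (auto simp: lin_ext_basis[of _ _ S])

lemma rota_baxter_identity_from_basis:
  assumes m: "bilinear_on R S S (free_module R S) m" and p: "linear_on R S (free_module R S) p"
    and c: "c \<in> carrier R"
    and eq: "\<And>s t. \<lbrakk>s \<in> S; t \<in> S\<rbrakk> \<Longrightarrow> m (p (basis R s)) (p (basis R t)) =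
      p (fadd R (fadd R (m (p (basis R s)) (basis R t)) (m (basis R s) (p (basis R t))))
        (fsmult R c (m (basis R s) (basis R t))))"
    and a: "a \<in> free_carrier R S" and b: "b \<in> free_carrier R S"
  shows "m (p a) (p b) = p (fadd R (fadd R (m (p a) b) (m a (p b))) (fsmult R c (m a b)))"
proof (rule bilinear_eqI[OF module_free_module _ _ _ a b, where f = "\<lambda>a b. m (p a) (p b)"
      and g = "\<lambda>a b. p (fadd R (fadd R (m (p a) b) (m a (p b))) (fsmult R c (m a b)))"])
  note id = linear_on_id[OF subset_refl]
  show "bilinear_on R S S (free_module R S) (\<lambda>a b. m (p a) (p b))"
    by (rule bilinear_on_compose2[OF m p p])
  show "bilinear_on R S S (free_module R S)
     (\<lambda>a b. p (fadd R (fadd R (m (p a) b) (m a (p b))) (fsmult R c (m a b))))"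
    using bilinear_on_compose[OF bilinear_on_add[OF module_free_module
      bilinear_on_add[OF module_free_module bilinear_on_compose2[OF m p id] bilinear_on_compose2[OF m id p]]
      bilinear_on_smult[OF module_free_module m c]] p] by simp
qed (rule eq)

text \<open>
  Writing \<open>a * b = p a \<cdot> b + a \<cdot> p b + l a \<cdot> b\<close>, so that \<open>p a \<cdot> p b = p (a * b)\<close>, both sides are \<open>p\<close> of a sum of seven
  products of three factors. The summands correspond to each other, each pair being associativity for a triple
  in which at least one of the three operators has been stripped.
\<close>

lemma rota_baxter_assoc_step:
  assumes m: "bilinear_on R S S (free_module R S) m" and p: "linear_on R S (free_module R S) p"
    and l: "l \<in> carrier R"
    and rb: "\<And>a b. \<lbrakk>a \<in> free_carrier R S; b \<in> free_carrier R S\<rbrakk> \<Longrightarrow> m (p a) (p b) =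
      p (fadd R (fadd R (m (p a) b) (m a (p b))) (fsmult R l (m a b)))"
    and a: "a \<in> free_carrier R S" and b: "b \<in> free_carrier R S" and c: "c \<in> free_carrier R S"
    and assoc:
      "m (m (p a) (p b)) c = m (p a) (m (p b) c)"
      "m (m (p a) b) (p c) = m (p a) (m b (p c))"
      "m (m a (p b)) (p c) = m a (m (p b) (p c))"
      "m (m (p a) b) c = m (p a) (m b c)"
      "m (m a (p b)) c = m a (m (p b) c)"
      "m (m a b) (p c) = m a (m b (p c))"
      "m (m a b) c = m a (m b c)"
  shows "m (m (p a) (p b)) (p c) = m (p a) (m (p b) (p c))"
proof -
  have pc: "\<And>x. x \<in> free_carrier R S \<Longrightarrow> p x \<in> free_carrier R S"
    using linear_onD(1)[OF p] by simp
  have mc: "\<And>x y. \<lbrakk>x \<in> free_carrier R S; y \<in> free_carrier R S\<rbrakk> \<Longrightarrow> m x y \<in> free_carrier R S"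
    using bilinear_onD(1)[OF m] by simp
  note bil = bilinear_onD(2-5)[OF m, simplified]
  \<comment> \<open>The bookkeeping of the seven summands, in the order in which the two expansions deliver them.\<close>
  have rearrange: "fadd R (fadd R x1 (fadd R (fadd R x2 x3) (fsmult R l x6)))
        (fsmult R l (fadd R (fadd R x4 x5) (fsmult R l x7)))
      = fadd R (fadd R (fadd R (fadd R x1 x2) (fsmult R l x4)) x3)
        (fsmult R l (fadd R (fadd R x5 x6) (fsmult R l x7)))"
    if "x1 \<in> free_carrier R S" "x2 \<in> free_carrier R S" "x3 \<in> free_carrier R S"
      "x4 \<in> free_carrier R S" "x5 \<in> free_carrier R S" "x6 \<in> free_carrier R S"
      "x7 \<in> free_carrier R S" for x1 x2 x3 x4 x5 x6 x7
  proof
    fix s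
    have "x1 s \<in> carrier R" "x2 s \<in> carrier R" "x3 s \<in> carrier R" "x4 s \<in> carrier R"
      "x5 s \<in> carrier R" "x6 s \<in> carrier R" "x7 s \<in> carrier R"
      using that by (simp_all add: free_carrier_val)
    with l show "fadd R (fadd R x1 (fadd R (fadd R x2 x3) (fsmult R l x6)))
        (fsmult R l (fadd R (fadd R x4 x5) (fsmult R l x7))) s
      = fadd R (fadd R (fadd R (fadd R x1 x2) (fsmult R l x4)) x3)
        (fsmult R l (fadd R (fadd R x5 x6) (fsmult R l x7))) s"
      by (simp add: free_operations_apply r_distr a_ac)
  qed
  \<comment> \<open>The elements \<open>a * b\<close> and \<open>b * c\<close>.\<close>
  define u where "u = fadd R (fadd R (m (p a) b) (m a (p b))) (fsmult R l (m a b))"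
  define v where "v = fadd R (fadd R (m (p b) c) (m b (p c))) (fsmult R l (m b c))"
  note cl = pc mc a b c l fadd_closed fsmult_closed
  have u: "u \<in> free_carrier R S" and v: "v \<in> free_carrier R S"
    unfolding u_def v_def by (intro cl)+
  have pu: "m (p a) (p b) = p u" and pv: "m (p b) (p c) = p v"
    unfolding u_def v_def using rb a b c by blast+
  have "m (p u) (p c) = p (fadd R (fadd R (m (m (p a) (p b)) c) (m u (p c))) (fsmult R l (m u c)))"
    using rb[OF u c] by (simp add: pu)
  also have "\<dots> = p (fadd R (fadd R (m (p a) v) (m a (m (p b) (p c)))) (fsmult R l (m a v)))"
  proof (rule arg_cong[where f = p])
    have "m u (p c) = fadd R (fadd R (m (m (p a) b) (p c)) (m (m a (p b)) (p c))) (fsmult R l (m (m a b) (p c)))"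
      "m u c = fadd R (fadd R (m (m (p a) b) c) (m (m a (p b)) c)) (fsmult R l (m (m a b) c))"
      unfolding u_def by (simp_all add: bil cl)
    moreover have
      "m (p a) v = fadd R (fadd R (m (p a) (m (p b) c)) (m (p a) (m b (p c)))) (fsmult R l (m (p a) (m b c)))"
      "m a v = fadd R (fadd R (m a (m (p b) c)) (m a (m b (p c)))) (fsmult R l (m a (m b c)))"
      unfolding v_def by (simp_all add: bil cl)
    ultimately show "fadd R (fadd R (m (m (p a) (p b)) c) (m u (p c))) (fsmult R l (m u c))
       = fadd R (fadd R (m (p a) v) (m a (m (p b) (p c)))) (fsmult R l (m a v))"
      unfolding assoc
      by (simp only:) (rule rearrange; intro cl)
  qed
  also have "\<dots> = m (p a) (p v)"
    using rb[OF a v] by (simp add: pv)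
  finally show ?thesis by (simp add: pu pv)
qed

end


section \<open>The algebra of forests\<close>

lemma leaves_simps [simp]:
  "leaves [] = 0" "leaves (T # F) = tree_leaves T + leaves F" "leaves (F @ G) = leaves F + leaves G"
  by (simp_all add: leaves_def)

lemma tree_leaves_Br: "F \<noteq> [] \<Longrightarrow> tree_leaves (Br F) = leaves F"
  by (simp add: leaves_def)

declare tree_leaves.simps [simp del]

lemma tree_leaves_dot [simp]: "tree_leaves dot = 1"
  by (simp add: tree_leaves.simps)

lemma tree_leaves_pos: "tree_leaves T > 0"
proof (induction T)
  case (Br F)
  then show ?case by (cases F) (auto simp: tree_leaves.simps)
qed

lemma leaves_pos: "F \<noteq> [] \<Longrightarrow> leaves F > 0"
  using tree_leaves_pos by (cases F) auto

text \<open>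
  Unlike \<^const>\<open>forests0\<close>, this condition holds for \<open>\<bullet>\<close> and is compatible with concatenation,
  which makes it the one to carry through recursions.
\<close>

definition reduced :: "pforest \<Rightarrow> bool" where
  "reduced F \<longleftrightarrow> (\<forall>T\<in>set F. Br [dot] \<notin> subtrees T)"

lemma reduced_append [simp]: "reduced (F @ G) \<longleftrightarrow> reduced F \<and> reduced G"
  by (auto simp: reduced_def)

lemma reduced_Cons: "reduced (T # F) \<longleftrightarrow> reduced [T] \<and> reduced F"
  by (auto simp: reduced_def)

lemma reduced_Br [simp]: "reduced [Br F] \<longleftrightarrow> F \<noteq> [dot] \<and> reduced F"
  by (auto simp: reduced_def)

lemma forests0_iff: "F \<in> forests0 \<longleftrightarrow> F \<noteq> [] \<and> F \<noteq> [dot] \<and> reduced F"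
  by (auto simp: forests0_def forests_def reduced_def)

text \<open>
  The shape of the forests occurring in a product, in the form needed for the induction: the leaf count makes
  decorations fit, and the last two clauses together give closure of \<^const>\<open>forests0\<close>. The
  last clause is what prevents a bracket \<open>\<lfloor>\<bullet>\<rfloor>\<close> from being created.
\<close>

definition product_support :: "pforest \<Rightarrow> pforest \<Rightarrow> pforest set" where
  "product_support F F' = {G. G \<noteq> [] \<and> leaves G + 1 = leaves F + leaves F' \<and>
     (reduced F \<and> reduced F' \<longrightarrow> reduced G) \<and> (G = [dot] \<longrightarrow> F = [dot] \<and> F' = [dot])}"

lemma product_support_context:
  assumes "G \<in> product_support [T] [T']"
  shows "U @ G @ V \<in> product_support (U @ [T]) (T' # V)"
  using assms by (auto simp: product_support_def reduced_Cons[of T' V] append_eq_Cons_conv)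

text \<open>
  The recursion of the product, with the coefficient ring and the weight stripped off so that they can stay
  fixed in an induction.
\<close>

lemma tree_forest_pair_induct [case_names dot_right dot_left brackets forests]:
  assumes "\<And>T. P T dot" "\<And>F. F \<noteq> [] \<Longrightarrow> P dot (Br F)"
    "\<And>F F'. \<lbrakk>F \<noteq> []; F' \<noteq> []; Q [Br F] F'; Q F [Br F']; Q F F'\<rbrakk> \<Longrightarrow> P (Br F) (Br F')"
    "\<And>F F'. (F \<noteq> [] \<Longrightarrow> F' \<noteq> [] \<Longrightarrow> P (last F) (hd F')) \<Longrightarrow> Q F F'"
  shows "P T T'" "Q F F'"
  by (rule tree_prod_forest_prod.induct[where P = "\<lambda>_ _. P" and Q = "\<lambda>_ _. Q"]; use assms in auto)+

lemma tree_prod_brackets: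
  assumes "F \<noteq> []" "F' \<noteq> []"
  shows "tree_prod k lam (Br F) (Br F') = fadd k (fadd k
       (bracket k (forest_prod k lam [Br F] F')) (bracket k (forest_prod k lam F [Br F'])))
       (fsmult k lam (bracket k (forest_prod k lam F F')))"
  using assms by (cases F; cases F') simp_all

declare forest_prod.simps [simp del]

lemma forest_prod_eq:
  assumes "F \<noteq> []" "F' \<noteq> []"
  shows "forest_prod k lam F F' =
    lin_ext k (\<lambda>G. basis k (butlast F @ G @ tl F')) (tree_prod k lam (last F) (hd F'))"
  using assms by (simp add: forest_prod.simps)

locale weighted_cring = cring k for k :: "('a, 'm) ring_scheme" (structure) +
  fixes lam :: 'a
  assumes lam_closed [simp, intro]: "lam \<in> carrier k"
begin

lemma bracket_linear:
  assumes "\<And>F. F \<in> S \<Longrightarrow> [Br F] \<in> T"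
  shows "linear_on k S (free_module k T) (bracket k)"
  unfolding bracket_def by (rule lin_ext_linear) (use assms in auto)

lemma bracket_closed:
  assumes "a \<in> free_carrier k S" "\<And>F. F \<in> S \<Longrightarrow> [Br F] \<in> T"
  shows "bracket k a \<in> free_carrier k T"
  using linear_onD(1)[OF bracket_linear[OF assms(2)] assms(1)] by simp

lemma bracket_basis [simp]: "bracket k (basis k F) = basis k [Br F]"
  unfolding bracket_def by (rule lin_ext_basis) auto

lemma bracket_linear_forests: "linear_on k forests (free_module k forests) (bracket k)"
  by (rule bracket_linear) (simp add: forests_def)

lemma prod_closed:
  shows "tree_prod k lam T T' \<in> free_carrier k (product_support [T] [T'])"
    and "F \<noteq> [] \<Longrightarrow> F' \<noteq> [] \<Longrightarrow> forest_prod k lam F F' \<in> free_carrier k (product_support F F')"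
proof (induction T T' and F F' rule: tree_forest_pair_induct)
  case (dot_right T)
  then show ?case by (auto simp: product_support_def intro!: basis_closed)
next
  case (dot_left F)
  then show ?case by (auto simp: product_support_def neq_Nil_conv intro!: basis_closed)
next
  case (brackets F F')
  let ?S = "product_support [Br F] [Br F']"
  have "bracket k (forest_prod k lam [Br F] F') \<in> free_carrier k ?S"
    by (rule bracket_closed) (use brackets in \<open>auto simp: product_support_def tree_leaves_Br\<close>)
  moreover have "bracket k (forest_prod k lam F [Br F']) \<in> free_carrier k ?S"
    by (rule bracket_closed) (use brackets in \<open>auto simp: product_support_def tree_leaves_Br\<close>)
  moreover have "bracket k (forest_prod k lam F F') \<in> free_carrier k ?S"
    by (rule bracket_closed) (use brackets in \<open>auto simp: product_support_def tree_leaves_Br\<close>)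
  ultimately show ?case using brackets by (simp add: tree_prod_brackets fadd_closed fsmult_closed)
next
  case (forests F F')
  then have IH: "tree_prod k lam (last F) (hd F') \<in> free_carrier k (product_support [last F] [hd F'])"
    by simp
  have "butlast F @ G @ tl F' \<in> product_support F F'" if "G \<in> product_support [last F] [hd F']" for G
    using product_support_context[OF that, of "butlast F" "tl F'"] forests(2,3) by simp
  then have "linear_on k (product_support [last F] [hd F']) (free_module k (product_support F F'))
     (lin_ext k (\<lambda>G. basis k (butlast F @ G @ tl F')))"
    by (intro lin_ext_linear) auto
  from linear_onD(1)[OF this IH] show ?case using forests(2,3) by (simp add: forest_prod_eq)
qed

lemma product_support_subset: "product_support F F' \<subseteq> forests"
  by (auto simp: product_support_def forests_def)

lemma forest_prod_forests:
  "F \<in> forests \<Longrightarrow> F' \<in> forests \<Longrightarrow> forest_prod k lam F F' \<in> free_carrier k forests"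
  using prod_closed(2) free_carrier_mono[OF product_support_subset] by (fastforce simp: forests_def)

lemma tree_prod_forests: "tree_prod k lam T T' \<in> free_carrier k forests"
  using prod_closed(1) free_carrier_mono[OF product_support_subset] by blast

definition fmul where "fmul = bilin_ext k (forest_prod k lam)"

text \<open>
  Bilinear concatenation \<open>\<squnion>\<close>. With it the product of forests is characterised by the product of
  trees and two laws for sliding a concatenation out of a product, which are easier to use in inductions than
  the indices of the last and the first tree.
\<close>

definition fcat :: "(pforest \<Rightarrow> 'a) \<Rightarrow> (pforest \<Rightarrow> 'a) \<Rightarrow> pforest \<Rightarrow> 'a" where
  "fcat = bilin_ext k (\<lambda>F G. basis k (F @ G))"

lemma fmul_bilinear: "bilinear_on k forests forests (free_module k forests) fmul"
  unfolding fmul_def by (rule bilin_ext_bilinear[OF forest_prod_forests])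

lemma fcat_bilinear:
  "(\<And>F G. F \<in> S \<Longrightarrow> G \<in> T \<Longrightarrow> F @ G \<in> U) \<Longrightarrow> bilinear_on k S T (free_module k U) fcat"
  unfolding fcat_def by (rule bilin_ext_bilinear) auto

lemma fcat_bilinear_forests: "bilinear_on k forests forests (free_module k forests) fcat"
  by (rule fcat_bilinear) (auto simp: forests_def)

lemma fmul_basis: "F \<in> forests \<Longrightarrow> F' \<in> forests \<Longrightarrow> fmul (basis k F) (basis k F') = forest_prod k lam F F'"
  unfolding fmul_def by (rule bilin_ext_basis) (rule forest_prod_forests)

lemma fcat_basis: "fcat (basis k F) (basis k G) = basis k (F @ G)"
  unfolding fcat_def by (rule bilin_ext_basis[where U = "{F @ G}"]) simp

lemma fmul_closed: "a \<in> free_carrier k forests \<Longrightarrow> b \<in> free_carrier k forests \<Longrightarrow> fmul a b \<in> free_carrier k forests"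
  using bilinear_onD(1)[OF fmul_bilinear] by simp

text \<open>
  The product only touches the last tree of its left factor, so everything to the left of that tree is
  untouched.
\<close>

lemma fcat_fmul:
  assumes "a \<in> free_carrier k forests" "b \<in> free_carrier k forests" "c \<in> free_carrier k forests"
  shows "fmul (fcat a b) c = fcat a (fmul b c)"
proof (rule trilinear_assoc_eqI[OF fmul_bilinear fcat_bilinear_forests fcat_bilinear_forests fmul_bilinear _ assms])
  fix F G H assume FGH: "F \<in> forests" "G \<in> forests" "H \<in> forests"
  then have FG: "F @ G \<in> forests" and ne: "G \<noteq> []" "H \<noteq> []" by (simp_all add: forests_def)
  have "lin_ext k (\<lambda>K. basis k (F @ butlast G @ K @ tl H)) (tree_prod k lam (last G) (hd H))
     = fcat (basis k F) (lin_ext k (\<lambda>K. basis k (butlast G @ K @ tl H)) (tree_prod k lam (last G) (hd H)))"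
  proof (rule linear_eqI[OF module_free_module, of forests forests, OF _ _ _ tree_prod_forests])
    show "linear_on k forests (free_module k forests) (lin_ext k (\<lambda>K. basis k (F @ butlast G @ K @ tl H)))"
      by (rule lin_ext_linear) (auto simp: forests_def)
    have "linear_on k forests (free_module k forests) (lin_ext k (\<lambda>K. basis k (butlast G @ K @ tl H)))"
      by (rule lin_ext_linear) (auto simp: forests_def)
    from linear_on_compose[OF this bilinear_on_linear(2)[OF fcat_bilinear_forests basis_closed[OF FGH(1)]]]
    show "linear_on k forests (free_module k forests)
       (\<lambda>a. fcat (basis k F) (lin_ext k (\<lambda>K. basis k (butlast G @ K @ tl H)) a))" .
  qed (simp add: lin_ext_basis[where T = UNIV] fcat_basis)
  then show "fmul (fcat (basis k F) (basis k G)) (basis k H) = fcat (basis k F) (fmul (basis k G) (basis k H))"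
    using FGH FG ne by (simp add: fcat_basis fmul_basis forest_prod_eq butlast_append)
qed

lemma fmul_fcat:
  assumes "a \<in> free_carrier k forests" "b \<in> free_carrier k forests" "c \<in> free_carrier k forests"
  shows "fcat (fmul a b) c = fmul a (fcat b c)"
proof (rule trilinear_assoc_eqI[OF fcat_bilinear_forests fmul_bilinear fmul_bilinear fcat_bilinear_forests _ assms])
  fix F G H assume FGH: "F \<in> forests" "G \<in> forests" "H \<in> forests"
  then have GH: "G @ H \<in> forests" and ne: "F \<noteq> []" "G \<noteq> []" by (simp_all add: forests_def)
  have "fcat (lin_ext k (\<lambda>K. basis k (butlast F @ K @ tl G)) (tree_prod k lam (last F) (hd G))) (basis k H)
     = lin_ext k (\<lambda>K. basis k (butlast F @ K @ tl G @ H)) (tree_prod k lam (last F) (hd G))"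
  proof (rule linear_eqI[OF module_free_module, of forests forests, OF _ _ _ tree_prod_forests])
    show "linear_on k forests (free_module k forests) (lin_ext k (\<lambda>K. basis k (butlast F @ K @ tl G @ H)))"
      by (rule lin_ext_linear) (auto simp: forests_def)
    have "linear_on k forests (free_module k forests) (lin_ext k (\<lambda>K. basis k (butlast F @ K @ tl G)))"
      by (rule lin_ext_linear) (auto simp: forests_def)
    from linear_on_compose[OF this bilinear_on_linear(1)[OF fcat_bilinear_forests basis_closed[OF FGH(3)]]]
    show "linear_on k forests (free_module k forests)
       (\<lambda>a. fcat (lin_ext k (\<lambda>K. basis k (butlast F @ K @ tl G)) a) (basis k H))" .
  qed (simp add: lin_ext_basis[where T = UNIV] fcat_basis)
  then show "fcat (fmul (basis k F) (basis k G)) (basis k H) = fmul (basis k F) (fcat (basis k G) (basis k H))"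
    using FGH GH ne by (simp add: fcat_basis fmul_basis forest_prod_eq)
qed

lemma forest_prod_trees: "forest_prod k lam [T] [T'] = tree_prod k lam T T'"
  using lin_ext_basis_id[OF tree_prod_forests] by (simp add: forest_prod_eq)

lemma fmul_dot:
  assumes "a \<in> free_carrier k forests"
  shows "fmul (basis k [dot]) a = a" "fmul a (basis k [dot]) = a"
proof -
  have d: "[dot] \<in> forests" by (simp add: forests_def)
  have 1: "forest_prod k lam [dot] F = basis k F" "forest_prod k lam F [dot] = basis k F"
    if "F \<in> forests" for F
  proof -
    have "tree_prod k lam dot T = basis k [T]" for T
      by (cases T; cases "T = dot") (auto simp: neq_Nil_conv)
    then show "forest_prod k lam [dot] F = basis k F" "forest_prod k lam F [dot] = basis k F"
      using that by (auto simp: forests_def forest_prod_eq lin_ext_basis[where T = UNIV])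
  qed
  show "fmul (basis k [dot]) a = a"
    by (rule linear_eqI[OF module_free_module bilinear_on_linear(2)[OF fmul_bilinear] linear_on_id _ assms])
       (use d 1 in \<open>auto simp: fmul_basis\<close>)
  show "fmul a (basis k [dot]) = a"
    by (rule linear_eqI[OF module_free_module bilinear_on_linear(1)[OF fmul_bilinear] linear_on_id _ assms])
       (use d 1 in \<open>auto simp: fmul_basis\<close>)
qed

text \<open>
  On brackets of basis elements the identity is the defining recursion of the product of trees.
\<close>

lemma fmul_rota_baxter:
  assumes "a \<in> free_carrier k forests" "b \<in> free_carrier k forests"
  shows "fmul (bracket k a) (bracket k b) = bracket k (fadd k (fadd k (fmul (bracket k a) b)
    (fmul a (bracket k b))) (fsmult k lam (fmul a b)))"
proof (rule rota_baxter_identity_from_basis[OF fmul_bilinear bracket_linear_forests lam_closed _ assms])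
  fix F F' assume F: "F \<in> forests" "F' \<in> forests"
  then have Br: "[Br F] \<in> forests" "[Br F'] \<in> forests" "F \<noteq> []" "F' \<noteq> []" by (simp_all add: forests_def)
  note cl = forest_prod_forests[OF F] forest_prod_forests[OF Br(1) F(2)] forest_prod_forests[OF F(1) Br(2)]
  show "fmul (bracket k (basis k F)) (bracket k (basis k F')) = bracket k (fadd k (fadd k
      (fmul (bracket k (basis k F)) (basis k F')) (fmul (basis k F) (bracket k (basis k F'))))
      (fsmult k lam (fmul (basis k F) (basis k F'))))"
    using F Br cl by (simp add: fmul_basis forest_prod_trees tree_prod_brackets
      linear_onD(2,3)[OF bracket_linear_forests, simplified])
qed

text \<open>
  If an outer factor has more than one tree, the two sliding laws for \<^const>\<open>fcat\<close> reduce the claim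
  to a smaller one; if the middle factor has more than one tree, they prove it outright, as the two products
  take place at different ends of that factor. There remain three trees, each of which is \<open>\<bullet>\<close>, the
  identity, or a bracket.
\<close>

lemma fmul_assoc_basis:
  "\<lbrakk>F \<in> forests; G \<in> forests; H \<in> forests\<rbrakk> \<Longrightarrow>
    fmul (fmul (basis k F) (basis k G)) (basis k H) = fmul (basis k F) (fmul (basis k G) (basis k H))"
proof (induction "size (Br F) + size (Br G) + size (Br H)" arbitrary: F G H rule: less_induct)
  case less
  note F = less.prems(1) and G = less.prems(2) and H = less.prems(3)
  have IH: "fmul (fmul (basis k F') (basis k G')) (basis k H') = fmul (basis k F') (fmul (basis k G') (basis k H'))"
    if "F' \<in> forests" "G' \<in> forests" "H' \<in> forests"
      "size (Br F') + size (Br G') + size (Br H') < size (Br F) + size (Br G) + size (Br H)" for F' G' H'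
    using less.hyps that by blast
  note cl = fmul_closed basis_closed
  obtain U T where FT: "F = U @ [T]" using F by (cases F rule: rev_cases) (auto simp: forests_def)
  obtain T' W where GT: "G = T' # W" using G by (cases G) (auto simp: forests_def)
  obtain T'' V where HT: "H = T'' # V" using H by (cases H) (auto simp: forests_def)
  have trees: "[T] \<in> forests" "[T'] \<in> forests" "[T''] \<in> forests" by (simp_all add: forests_def)
  consider "U \<noteq> []" | "W \<noteq> []" | "V \<noteq> []" | "U = []" "W = []" "V = []" by blast
  then show ?case
  proof cases
    case 1
    then have U: "U \<in> forests" by (simp add: forests_def)
    have "basis k F = fcat (basis k U) (basis k [T])" by (simp add: FT fcat_basis)
    moreover have "fmul (fmul (basis k [T]) (basis k G)) (basis k H) = fmul (basis k [T]) (fmul (basis k G) (basis k H))"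
      by (rule IH) (use trees G H 1 in \<open>auto simp: FT size_Br neq_Nil_conv\<close>)
    ultimately show ?thesis using trees U G H by (simp add: fcat_fmul cl)
  next
    case 2
    then have W: "W \<in> forests" by (simp add: forests_def)
    have "basis k G = fcat (basis k [T']) (basis k W)" by (simp add: GT fcat_basis)
    then show ?thesis using trees W F H by (simp add: fcat_fmul cl flip: fmul_fcat)
  next
    case 3
    then have V: "V \<in> forests" by (simp add: forests_def)
    have "basis k H = fcat (basis k [T'']) (basis k V)" by (simp add: HT fcat_basis)
    moreover have "fmul (fmul (basis k F) (basis k G)) (basis k [T'']) = fmul (basis k F) (fmul (basis k G) (basis k [T'']))"
      by (rule IH) (use trees F G 3 in \<open>auto simp: HT size_Br neq_Nil_conv\<close>)
    ultimately show ?thesis using trees V F G by (simp add: cl flip: fmul_fcat)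
  next
    case 4
    obtain A B C where ABC: "T = Br A" "T' = Br B" "T'' = Br C" by (meson ptree.exhaust)
    consider "A = []" | "B = []" | "C = []" | "A \<noteq> []" "B \<noteq> []" "C \<noteq> []" by blast
    then show ?thesis
    proof cases
      case 4
      have FGH: "F = [Br A]" "G = [Br B]" "H = [Br C]"
        using FT GT HT ABC \<open>U = []\<close> \<open>V = []\<close> \<open>W = []\<close> by simp_all
      from 4 have f: "A \<in> forests" "B \<in> forests" "C \<in> forests" "[Br A] \<in> forests" "[Br B] \<in> forests" "[Br C] \<in> forests"
        by (simp_all add: forests_def)
      have sizes: "size (Br F) + size (Br G) + size (Br H) = size (Br A) + size (Br B) + size (Br C) + 6"
        by (simp add: FGH size_Br del: ptree.size)
      have Br_size: "size (Br [Br K]) = size (Br K) + 2" for K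
        by (simp add: size_Br del: ptree.size)
      note step = rota_baxter_assoc_step[where m = fmul and p = "bracket k" and l = lam and S = forests
          and a = "basis k A" and b = "basis k B" and c = "basis k C",
          OF fmul_bilinear bracket_linear_forests lam_closed fmul_rota_baxter, unfolded bracket_basis]
      have "fmul (fmul (basis k [Br A]) (basis k [Br B])) (basis k [Br C]) =
        fmul (basis k [Br A]) (fmul (basis k [Br B]) (basis k [Br C]))"
        by (rule step; (rule IH basis_closed)?; (rule f)?; (unfold sizes Br_size)?; linarith?)
      then show ?thesis by (simp add: FGH)
    qed (use 4 FT GT HT F G H in \<open>auto simp: ABC fmul_dot cl\<close>)
  qed
qed

lemma fmul_assoc:
  assumes "a \<in> free_carrier k forests" "b \<in> free_carrier k forests" "c \<in> free_carrier k forests"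
  shows "fmul (fmul a b) c = fmul a (fmul b c)"
  by (rule trilinear_assoc_eqI[OF fmul_bilinear fmul_bilinear fmul_bilinear fmul_bilinear fmul_assoc_basis assms])

end


section \<open>Decorated forests\<close>

text \<open>
  The index is the number of decorations of the forest, one less than its number of leaves; with this
  convention the product is additive in the index.
\<close>

definition graded :: "nat \<Rightarrow> pforest set" where
  "graded n = {F \<in> forests. leaves F = Suc n}"

lemma gradedD: "F \<in> graded n \<Longrightarrow> F \<in> forests" "F \<in> graded n \<Longrightarrow> F \<noteq> []" "F \<in> graded n \<Longrightarrow> leaves F = Suc n"
  by (auto simp: graded_def forests_def)

lemma decorated_iff: "(F, xs) \<in> decorated_forests X \<longleftrightarrow> F \<in> graded (length xs) \<and> xs \<in> lists X"
  using leaves_pos[of F] by (auto simp: decorated_forests_def graded_def forests_def)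

lemma graded_Br: "F \<noteq> [] \<Longrightarrow> [Br F] \<in> graded n \<longleftrightarrow> F \<in> graded n"
  by (auto simp: graded_def forests_def tree_leaves_Br)

lemma graded_dot: "[dot] \<in> graded n \<longleftrightarrow> n = 0"
  by (auto simp: graded_def forests_def)

lemma graded_append:
  "F \<in> graded m \<Longrightarrow> G \<in> graded n \<Longrightarrow> F @ G \<in> graded (m + Suc n)"
  by (auto simp: graded_def forests_def)

lemma product_support_graded:
  "F \<in> graded m \<Longrightarrow> G \<in> graded n \<Longrightarrow> product_support F G \<subseteq> graded (m + n)"
  by (auto simp: graded_def product_support_def forests_def)

lemma product_support_forests0:
  "F \<in> forests0 \<Longrightarrow> G \<in> forests0 \<Longrightarrow> product_support F G \<subseteq> forests0"
  by (auto simp: forests0_iff product_support_def)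

lemma split_decoration:
  assumes "U @ W \<in> graded (length xs)" "U \<noteq> []" "W \<noteq> []" "xs \<in> lists X"
  obtains us x ws where "xs = us @ x # ws" "U \<in> graded (length us)" "W \<in> graded (length ws)"
    "us \<in> lists X" "x \<in> X" "ws \<in> lists X"
proof -
  obtain n where n: "leaves U = Suc n"
    using leaves_pos[OF assms(2)] by (cases "leaves U") auto
  obtain m where m: "leaves W = Suc m"
    using leaves_pos[OF assms(3)] by (cases "leaves W") auto
  have len: "length xs = n + Suc m" using assms(1) n m by (simp add: graded_def)
  then have xs: "xs = take n xs @ xs ! n # drop (Suc n) xs"
    by (simp add: id_take_nth_drop)
  show ?thesis
  proof (rule that[OF xs])
    show "U \<in> graded (length (take n xs))" "W \<in> graded (length (drop (Suc n) xs))"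
      using len n m assms(2,3) by (simp_all add: graded_def forests_def)
    show "take n xs \<in> lists X" "xs ! n \<in> X" "drop (Suc n) xs \<in> lists X"
      using assms(4) len by (auto dest: in_set_takeD in_set_dropD)
  qed
qed

text \<open>
  Decorations sit between consecutive leaves, so the leaf count of the first tree singles out one letter,
  the one that separates this tree from the rest. The join step is shaped so that it becomes a product with
  the generator of that letter in the middle.
\<close>

lemma decorated_induct [consumes 2, case_names dot bracket join]:
  assumes "F \<in> graded (length xs)" "xs \<in> lists X"
    and dot: "Q [dot] []"
    and bracket: "\<And>F xs. \<lbrakk>F \<in> graded (length xs); xs \<in> lists X; Q F xs\<rbrakk> \<Longrightarrow> Q [Br F] xs"
    and join: "\<And>T xs x F ys. \<lbrakk>[T] \<in> graded (length xs); xs \<in> lists X; x \<in> X;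
      F \<in> graded (length ys); ys \<in> lists X; Q [T] xs; Q F ys\<rbrakk> \<Longrightarrow> Q (T # F) (xs @ x # ys)"
  shows "Q F xs"
  using assms(1,2)
proof (induction "size (Br F)" arbitrary: F xs rule: less_induct)
  case less
  obtain T W where F: "F = T # W" using gradedD(2)[OF less.prems(1)] by (cases F) auto
  obtain H where T: "T = Br H" by (cases T)
  show ?case
  proof (cases "W = []")
    case True
    show ?thesis
    proof (cases "H = []")
      case True
      with \<open>W = []\<close> less.prems dot show ?thesis by (simp add: F T graded_dot)
    next
      case False
      then have "H \<in> graded (length xs)" using less.prems \<open>W = []\<close> by (simp add: F T graded_Br)
      moreover have "Q H xs"
        by (rule less.hyps) (use calculation less.prems \<open>W = []\<close> in \<open>simp_all add: F T size_Br\<close>)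
      ultimately show ?thesis using bracket less.prems \<open>W = []\<close> by (simp add: F T)
    qed
  next
    case False
    obtain ts x ws where s: "xs = ts @ x # ws" "[T] \<in> graded (length ts)" "W \<in> graded (length ws)"
      "ts \<in> lists X" "x \<in> X" "ws \<in> lists X"
      using split_decoration[of "[T]" W xs X] less.prems False by (auto simp: F)
    have "Q [T] ts" "Q W ws"
      by (rule less.hyps; use s False in \<open>auto simp: F size_Br neq_Nil_conv\<close>)+
    then show ?thesis using join s by (simp add: F)
  qed
qed

context weighted_cring
begin

text \<open>
  Attaching a fixed tuple of decorations, linearly. The product of decorated forests multiplies forests and
  concatenates decorations, so all laws for it follow from those for forests along these maps.
\<close>

definition dec :: "'x list \<Rightarrow> (pforest \<Rightarrow> 'a) \<Rightarrow> 'x decorated \<Rightarrow> 'a" where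
  "dec xs = lin_ext k (\<lambda>F. basis k (F, xs))"

lemma dec_linear:
  "(\<And>F. F \<in> S \<Longrightarrow> (F, xs) \<in> D) \<Longrightarrow> linear_on k S (free_module k D) (dec xs)"
  unfolding dec_def by (rule lin_ext_linear) auto

lemma dec_closed:
  assumes "a \<in> free_carrier k S" "\<And>F. F \<in> S \<Longrightarrow> (F, xs) \<in> D"
  shows "dec xs a \<in> free_carrier k D"
  using linear_onD(1)[OF dec_linear[OF assms(2)] assms(1)] by simp

lemma dec_basis [simp]: "dec xs (basis k F) = basis k (F, xs)"
  unfolding dec_def by (rule lin_ext_basis) auto

lemma dec_linear_graded:
  "xs \<in> lists X \<Longrightarrow> linear_on k (graded (length xs)) (free_module k (decorated_forests X)) (dec xs)"
  by (rule dec_linear) (simp add: decorated_iff)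

text \<open>
  The basis of \<^const>\<open>Sh_NC0\<close>. Several facts below are stated for a set that is either this one or
  the full basis, since the two algebras share their operations.
\<close>

abbreviation reduced_decorated :: "'x set \<Rightarrow> 'x decorated set" where
  "reduced_decorated X \<equiv> {(F, xs) \<in> decorated_forests X. F \<in> forests0}"

lemma sh_mult_eq: "sh_mult k lam =
  bilin_ext k (\<lambda>p q. dec (snd p @ snd q) (forest_prod k lam (fst p) (fst q)))"
  by (simp add: fun_eq_iff sh_mult_def bilin_ext_def dec_def case_prod_unfold)

lemma forest_prod_graded:
  "F \<in> graded m \<Longrightarrow> G \<in> graded n \<Longrightarrow> forest_prod k lam F G \<in> free_carrier k (graded (m + n))"
  using prod_closed(2)[of F G] free_carrier_mono[OF product_support_graded, of F m G n k] gradedD(2) by blast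

lemma fmul_bilinear_graded:
  "bilinear_on k (graded m) (graded n) (free_module k (graded (m + n))) fmul"
  unfolding fmul_def by (rule bilin_ext_bilinear) (rule forest_prod_graded)

lemma sh_mult_basis_closed:
  assumes "p \<in> S" "q \<in> S" "S = decorated_forests X \<or> S = reduced_decorated X"
  shows "dec (snd p @ snd q) (forest_prod k lam (fst p) (fst q)) \<in> free_carrier k S"
proof (cases p; cases q)
  fix F xs G ys assume p: "p = (F, xs)" and q: "q = (G, ys)"
  have g: "F \<in> graded (length xs)" "G \<in> graded (length ys)" "xs \<in> lists X" "ys \<in> lists X"
    using assms by (auto simp: p q decorated_iff)
  have "product_support F G \<subseteq> graded (length (xs @ ys))"
    using product_support_graded[OF g(1,2)] by simp
  moreover have "S = reduced_decorated X \<Longrightarrow> product_support F G \<subseteq> forests0"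
    using product_support_forests0 assms by (auto simp: p q)
  ultimately have "K \<in> product_support F G \<Longrightarrow> (K, xs @ ys) \<in> S" for K
    using assms(3) g by (auto simp: decorated_iff)
  moreover have "forest_prod k lam F G \<in> free_carrier k (product_support F G)"
    using g gradedD(2) by (intro prod_closed(2)) auto
  ultimately show ?thesis unfolding p q fst_conv snd_conv by (rule dec_closed[rotated])
qed

lemma sh_mult_bilinear:
  assumes "S = decorated_forests X \<or> S = reduced_decorated X"
  shows "bilinear_on k S S (free_module k S) (sh_mult k lam)"
  unfolding sh_mult_eq by (rule bilin_ext_bilinear) (rule sh_mult_basis_closed[OF _ _ assms])

lemma sh_mult_basis:
  assumes "(F, xs) \<in> decorated_forests X" "(G, ys) \<in> decorated_forests X"
  shows "sh_mult k lam (basis k (F, xs)) (basis k (G, ys)) = dec (xs @ ys) (forest_prod k lam F G)"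
  unfolding sh_mult_eq
  using bilin_ext_basis[of "\<lambda>p q. dec (snd p @ snd q) (forest_prod k lam (fst p) (fst q))",
      OF sh_mult_basis_closed[OF assms disjI1[OF refl]]] by simp

lemma sh_mult_dec:
  assumes "xs \<in> lists X" "ys \<in> lists X"
    and "a \<in> free_carrier k (graded (length xs))" "b \<in> free_carrier k (graded (length ys))"
  shows "sh_mult k lam (dec xs a) (dec ys b) = dec (xs @ ys) (fmul a b)"
proof (rule bilinear_eqI[OF module_free_module _ _ _ assms(3,4),
      where f = "\<lambda>a b. sh_mult k lam (dec xs a) (dec ys b)" and g = "\<lambda>a b. dec (xs @ ys) (fmul a b)"])
  show "bilinear_on k (graded (length xs)) (graded (length ys)) (free_module k (decorated_forests X))
      (\<lambda>a b. sh_mult k lam (dec xs a) (dec ys b))"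
    by (rule bilinear_on_compose2[OF sh_mult_bilinear dec_linear_graded dec_linear_graded]) (use assms in auto)
  have "linear_on k (graded (length xs + length ys)) (free_module k (decorated_forests X)) (dec (xs @ ys))"
    using dec_linear_graded[of "xs @ ys" X] assms by simp
  then show "bilinear_on k (graded (length xs)) (graded (length ys)) (free_module k (decorated_forests X))
      (\<lambda>a b. dec (xs @ ys) (fmul a b))"
    by (rule bilinear_on_compose[OF fmul_bilinear_graded])
qed (use assms gradedD(1) in \<open>auto simp: sh_mult_basis[where X = X] decorated_iff fmul_basis\<close>)

lemma sh_op_eq: "sh_op k = lin_ext k (\<lambda>p. basis k ([Br (fst p)], snd p))"
  by (simp add: fun_eq_iff sh_op_def case_prod_unfold)

lemma sh_op_linear:
  assumes "S = decorated_forests X \<or> S = reduced_decorated X"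
  shows "linear_on k S (free_module k S) (sh_op k)"
  unfolding sh_op_eq
proof (rule lin_ext_linear, rule basis_closed)
  fix p assume "p \<in> S"
  then show "([Br (fst p)], snd p) \<in> S"
    using assms gradedD(2) by (cases p) (auto simp: decorated_iff graded_Br forests0_iff)
qed

lemma sh_op_basis [simp]: "sh_op k (basis k (F, xs)) = basis k ([Br F], xs)"
  unfolding sh_op_eq by (subst lin_ext_basis[where T = UNIV]) auto

lemma sh_op_dec:
  assumes "xs \<in> lists X" "a \<in> free_carrier k (graded (length xs))"
  shows "sh_op k (dec xs a) = dec xs (bracket k a)"
proof (rule linear_eqI[OF module_free_module _ _ _ assms(2),
      where f = "\<lambda>a. sh_op k (dec xs a)" and g = "\<lambda>a. dec xs (bracket k a)"])
  show "linear_on k (graded (length xs)) (free_module k (decorated_forests X)) (\<lambda>a. sh_op k (dec xs a))"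
    by (rule linear_on_compose[OF dec_linear_graded sh_op_linear]) (use assms in auto)
  show "linear_on k (graded (length xs)) (free_module k (decorated_forests X)) (\<lambda>a. dec xs (bracket k a))"
    by (rule linear_on_compose[OF bracket_linear dec_linear_graded])
      (use assms gradedD(2) in \<open>auto simp: graded_Br\<close>)
qed simp

lemma sh_mult_assoc:
  assumes "a \<in> free_carrier k (decorated_forests X)" "b \<in> free_carrier k (decorated_forests X)" "c \<in> free_carrier k (decorated_forests X)"
  shows "sh_mult k lam (sh_mult k lam a b) c = sh_mult k lam a (sh_mult k lam b c)"
proof -
  note m = sh_mult_bilinear[OF disjI1[OF refl], of X]
  show ?thesis
  proof (rule trilinear_assoc_eqI[OF m m m m _ assms])
    fix p q r assume "p \<in> decorated_forests X" "q \<in> decorated_forests X" "r \<in> decorated_forests X"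
    then obtain F xs G ys H zs where p: "p = (F, xs)" "q = (G, ys)" "r = (H, zs)"
      and g: "F \<in> graded (length xs)" "G \<in> graded (length ys)" "H \<in> graded (length zs)"
      and l: "xs \<in> lists X" "ys \<in> lists X" "zs \<in> lists X"
      by (cases p; cases q; cases r) (auto simp: decorated_iff)
    have g': "basis k F \<in> free_carrier k (graded (length xs))" "basis k G \<in> free_carrier k (graded (length ys))"
      "basis k H \<in> free_carrier k (graded (length zs))" using g by auto
    have "fmul (basis k F) (basis k G) \<in> free_carrier k (graded (length (xs @ ys)))"
      "fmul (basis k G) (basis k H) \<in> free_carrier k (graded (length (ys @ zs)))"
      using bilinear_onD(1)[OF fmul_bilinear_graded g'(1,2)] bilinear_onD(1)[OF fmul_bilinear_graded g'(2,3)] by simp_all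
    moreover have "fmul (fmul (basis k F) (basis k G)) (basis k H) = fmul (basis k F) (fmul (basis k G) (basis k H))"
      by (rule fmul_assoc) (use g gradedD(1) in auto)
    ultimately have "sh_mult k lam (sh_mult k lam (dec xs (basis k F)) (dec ys (basis k G))) (dec zs (basis k H)) =
      sh_mult k lam (dec xs (basis k F)) (sh_mult k lam (dec ys (basis k G)) (dec zs (basis k H)))"
      using l g' by (simp add: sh_mult_dec[where X = X] del: dec_basis)
    then show "sh_mult k lam (sh_mult k lam (basis k p) (basis k q)) (basis k r) =
      sh_mult k lam (basis k p) (sh_mult k lam (basis k q) (basis k r))"
      by (simp add: p)
  qed
qed

lemma sh_rota_baxter:
  assumes "a \<in> free_carrier k (decorated_forests X)" "b \<in> free_carrier k (decorated_forests X)"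
  shows "sh_mult k lam (sh_op k a) (sh_op k b) = sh_op k (fadd k (fadd k (sh_mult k lam (sh_op k a) b)
    (sh_mult k lam a (sh_op k b))) (fsmult k lam (sh_mult k lam a b)))"
proof -
  note m = sh_mult_bilinear[OF disjI1[OF refl], of X] and p = sh_op_linear[OF disjI1[OF refl], of X]
  show ?thesis
  proof (rule rota_baxter_identity_from_basis[where m = "sh_mult k lam" and p = "sh_op k", OF m p lam_closed _ assms])
    fix p q assume "p \<in> decorated_forests X" "q \<in> decorated_forests X"
    then obtain F xs G ys where p: "p = (F, xs)" "q = (G, ys)"
      and g: "F \<in> graded (length xs)" "G \<in> graded (length ys)"
      and l: "xs \<in> lists X" "ys \<in> lists X"
      by (cases p; cases q) (auto simp: decorated_iff)
    let ?n = "length (xs @ ys)"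
    have b: "[Br F] \<in> graded (length xs)" "[Br G] \<in> graded (length ys)"
      using g gradedD(2) by (auto simp: graded_Br)
    have f: "F \<in> forests" "G \<in> forests" using g gradedD(1) by auto
    have c: "fmul (basis k [Br F]) (basis k G) \<in> free_carrier k (graded ?n)"
      "fmul (basis k F) (basis k [Br G]) \<in> free_carrier k (graded ?n)"
      "fmul (basis k F) (basis k G) \<in> free_carrier k (graded ?n)"
      using g b by (auto intro!: bilinear_onD(1)[OF fmul_bilinear_graded, simplified])
    note lin = linear_onD[OF dec_linear_graded[of "xs @ ys" X], simplified]
    have "sh_mult k lam (dec xs (basis k [Br F])) (dec ys (basis k [Br G])) =
      dec (xs @ ys) (bracket k (fadd k (fadd k (fmul (basis k [Br F]) (basis k G))
        (fmul (basis k F) (basis k [Br G]))) (fsmult k lam (fmul (basis k F) (basis k G)))))"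
      using l b f fmul_rota_baxter[of "basis k F" "basis k G"] by (simp add: sh_mult_dec[where X = X] del: dec_basis)
    also have "\<dots> = sh_op k (dec (xs @ ys) (fadd k (fadd k (fmul (basis k [Br F]) (basis k G))
        (fmul (basis k F) (basis k [Br G]))) (fsmult k lam (fmul (basis k F) (basis k G)))))"
      by (rule sh_op_dec[symmetric, of _ X]) (use l c in \<open>auto simp del: length_append\<close>)
    also have "dec (xs @ ys) (fadd k (fadd k (fmul (basis k [Br F]) (basis k G))
        (fmul (basis k F) (basis k [Br G]))) (fsmult k lam (fmul (basis k F) (basis k G)))) =
      fadd k (fadd k (sh_mult k lam (dec xs (basis k [Br F])) (dec ys (basis k G)))
        (sh_mult k lam (dec xs (basis k F)) (dec ys (basis k [Br G]))))
        (fsmult k lam (sh_mult k lam (dec xs (basis k F)) (dec ys (basis k G))))"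
      using l b g c by (simp add: sh_mult_dec[where X = X] lin fadd_closed fsmult_closed del: dec_basis)
    finally show "sh_mult k lam (sh_op k (basis k p)) (sh_op k (basis k q)) =
        sh_op k (fadd k (fadd k (sh_mult k lam (sh_op k (basis k p)) (basis k q))
          (sh_mult k lam (basis k p) (sh_op k (basis k q))))
        (fsmult k lam (sh_mult k lam (basis k p) (basis k q))))"
      by (simp add: p)
  qed
qed

lemma sh_mult_one:
  assumes "a \<in> free_carrier k (decorated_forests X)"
  shows "sh_mult k lam (basis k ([dot], [])) a = a" "sh_mult k lam a (basis k ([dot], [])) = a"
proof -
  note m = sh_mult_bilinear[OF disjI1[OF refl], of X]
  have d: "([dot], []) \<in> decorated_forests X" by (simp add: decorated_iff graded_dot)
  have b: "[dot] \<in> forests" by (simp add: forests_def)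
  have 1: "forest_prod k lam [dot] F = basis k F" "forest_prod k lam F [dot] = basis k F" if "F \<in> forests" for F
    using fmul_basis[OF b that] fmul_basis[OF that b] fmul_dot[OF basis_closed[OF that]] by simp_all
  show "sh_mult k lam (basis k ([dot], [])) a = a"
    by (rule linear_eqI[OF module_free_module bilinear_on_linear(2)[OF m] linear_on_id _ assms])
       (use d 1 gradedD(1) in \<open>auto simp: sh_mult_basis[where X = X] decorated_iff\<close>)
  show "sh_mult k lam a (basis k ([dot], [])) = a"
    by (rule linear_eqI[OF module_free_module bilinear_on_linear(1)[OF m] linear_on_id _ assms])
       (use d 1 gradedD(1) in \<open>auto simp: sh_mult_basis[where X = X] decorated_iff\<close>)
qed

lemma rota_baxter_of_sh_operations:
  assumes S: "S = decorated_forests X \<or> S = reduced_decorated X"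
    and A: "carrier A = free_carrier k S" "zero A = fzero k" "add A = fadd k" "smult A = fsmult k"
      "mult A = sh_mult k lam" "rbop A = sh_op k"
  shows "rota_baxter k lam A"
proof -
  interpret A: "module" k A by (rule module_of_free_carrier[OF A(1-4)])
  have sub: "free_carrier k S \<subseteq> free_carrier k (decorated_forests X)" using S by (intro free_carrier_mono) auto
  note m = bilinear_onD[OF sh_mult_bilinear[OF S], simplified]
  note p = linear_onD[OF sh_op_linear[OF S], simplified]
  show ?thesis
    by unfold_locales
       (use m p sh_mult_assoc[of _ X] sh_rota_baxter[of _ X] sub in \<open>auto simp: A subset_iff\<close>)
qed

lemma Sh_NC0_rota_baxter: "rota_baxter k lam (Sh_NC0 k lam X)"
  by (rule rota_baxter_of_sh_operations[of "reduced_decorated X" X]) (simp_all add: Sh_NC0_def Sh_NC_def)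

lemma Sh_NC_rota_baxter: "rota_baxter k lam (Sh_NC k lam X)"
  by (rule rota_baxter_of_sh_operations[of "decorated_forests X" X]) (simp_all add: Sh_NC_def)

lemma Sh_NC_unitary: "unitary_rota_baxter k lam (Sh_NC k lam X)"
proof -
  interpret A: rota_baxter k lam "Sh_NC k lam X" by (rule Sh_NC_rota_baxter)
  have "([dot], []) \<in> decorated_forests X" by (simp add: decorated_iff graded_dot)
  then have "monoid (Sh_NC k lam X)"
    using sh_mult_one A.mult_closed A.mult_assoc by (intro monoidI) (auto simp: Sh_NC_def)
  then show ?thesis by (intro unitary_rota_baxter.intro Sh_NC_rota_baxter)
qed

end


section \<open>Homomorphisms are determined by the generators\<close>

lemma rb_homD:
  assumes "f \<in> rb_hom k A B"
  shows "x \<in> carrier A \<Longrightarrow> f x \<in> carrier B"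
    and "\<lbrakk>x \<in> carrier A; y \<in> carrier A\<rbrakk> \<Longrightarrow> f (x \<otimes>\<^bsub>A\<^esub> y) = f x \<otimes>\<^bsub>B\<^esub> f y"
    and "x \<in> carrier A \<Longrightarrow> f (rbop A x) = rbop B (f x)"
  using assms by (auto simp: rb_hom_def)

lemma rb_hom_linear:
  assumes "f \<in> rb_hom k A B" "carrier A = free_carrier k S" "add A = fadd k" "smult A = fsmult k"
  shows "linear_on k S B f"
  using assms by (auto simp: rb_hom_def linear_on_def)

lemma rb_hom_compose:
  assumes A: "rota_baxter k lam A" and f: "f \<in> rb_hom k A B" and g: "g \<in> rb_hom k B C"
  shows "restrict (\<lambda>a. g (f a)) (carrier A) \<in> rb_hom k A C"
proof -
  interpret A: rota_baxter k lam A by fact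
  show ?thesis
    using f g A.a_closed A.mult_closed A.smult_closed A.rbop_closed
    by (auto simp: rb_hom_def PiE_iff)
qed

context weighted_cring
begin

text \<open>
  Multiplication by the generator appends a leaf; the next product is then taken with that leaf, which acts as
  identity on the first tree of the right factor.
\<close>

lemma sh_mult_generator:
  assumes "F \<in> graded (length xs)" "G \<in> graded (length ys)" "xs \<in> lists X" "ys \<in> lists X" "x \<in> X"
  shows "sh_mult k lam (basis k (F, xs)) (basis k ([dot, dot], [x])) = basis k (F @ [dot], xs @ [x])"
    and "sh_mult k lam (basis k (F @ [dot], xs @ [x])) (basis k (G, ys)) = basis k (F @ G, xs @ x # ys)"
proof -
  have j: "([dot, dot], [x]) \<in> decorated_forests X" using assms by (simp add: decorated_iff graded_def forests_def)
  have F: "(F, xs) \<in> decorated_forests X" and G: "(G, ys) \<in> decorated_forests X" using assms by (simp_all add: decorated_iff)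
  have Fj: "(F @ [dot], xs @ [x]) \<in> decorated_forests X"
    using assms graded_append[OF assms(1), of "[dot]" 0] by (simp add: decorated_iff graded_dot)
  have dot: "tree_prod k lam dot T = basis k [T]" for T
    by (cases T; cases "T = dot") (auto simp: neq_Nil_conv)
  have ne: "F \<noteq> []" "G \<noteq> []" using assms gradedD(2) by auto
  have snoc: "butlast F @ [last F, dot] = F @ [dot]"
    using ne by (cases F rule: rev_cases) auto
  show "sh_mult k lam (basis k (F, xs)) (basis k ([dot, dot], [x])) = basis k (F @ [dot], xs @ [x])"
    using ne by (simp add: sh_mult_basis[OF F j] forest_prod_eq lin_ext_basis[where T = UNIV] snoc)
  show "sh_mult k lam (basis k (F @ [dot], xs @ [x])) (basis k (G, ys)) = basis k (F @ G, xs @ x # ys)"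
    using ne by (simp add: sh_mult_basis[OF Fj G] forest_prod_eq dot lin_ext_basis[where T = UNIV])
qed

text \<open>
  Both maps are computed from the generators by following how a decorated forest is produced. In a join
  \<open>(T\<squnion>F; xs, x, ys)\<close> a factor \<open>\<bullet>\<close> is dropped rather than multiplied, which keeps all factors inside the
  nonunitary algebra; the identity itself has to be compared only when it belongs to the algebra.
\<close>

lemma rb_hom_eqI:
  fixes A :: "('a, 'x decorated \<Rightarrow> 'a) rb" and B :: "('a, 'b, 'c) rb_scheme"
  assumes S: "S = decorated_forests X \<or> S = reduced_decorated X"
    and A: "carrier A = free_carrier k S" "add A = fadd k" "smult A = fsmult k"
      "mult A = sh_mult k lam" "rbop A = sh_op k"
    and B: "module k B"
    and u: "u \<in> rb_hom k A B" and v: "v \<in> rb_hom k A B"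
    and gen: "\<And>x. x \<in> X \<Longrightarrow> u (basis k ([dot, dot], [x])) = v (basis k ([dot, dot], [x]))"
    and unit: "([dot], []) \<in> S \<Longrightarrow> u (basis k ([dot], [])) = v (basis k ([dot], []))"
    and a: "a \<in> carrier A"
  shows "u a = v a"
proof (rule linear_eqI[OF B rb_hom_linear[OF u A(1-3)] rb_hom_linear[OF v A(1-3)] _ a[unfolded A]])
  note uD = rb_homD[OF u, unfolded A] and vD = rb_homD[OF v, unfolded A]
  have bracketS: "([Br F], xs) \<in> S \<Longrightarrow> (F, xs) \<in> S" if "F \<in> graded (length xs)" for F and xs :: "'x list"
    using S that gradedD(2)[OF that] by (auto simp: decorated_iff forests0_iff)
  have *: "(F, xs) \<in> S \<Longrightarrow> u (basis k (F, xs)) = v (basis k (F, xs))"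
    if "F \<in> graded (length xs)" "xs \<in> lists X" for F xs
    using that
  proof (induction F xs rule: decorated_induct)
    case dot
    then show ?case by (rule unit)
  next
    case (bracket F xs)
    then have F: "(F, xs) \<in> S" by (blast intro: bracketS)
    then show ?case
      using uD(3)[OF basis_closed[OF F]] vD(3)[OF basis_closed[OF F]] bracket by simp
  next
    case (join T xs x F ys)
    note gen_mult = sh_mult_generator[OF join(1,4,2,5,3)]
    have red: "S = reduced_decorated X \<Longrightarrow> reduced [T] \<and> reduced F"
      using join.prems by (auto simp: forests0_iff reduced_Cons[of T F])
    have rd: "reduced [dot]" by (simp add: reduced_def)
    have j: "([dot, dot], [x]) \<in> S"
      using S join by (auto simp: decorated_iff graded_def forests_def forests0_iff reduced_def)
    have left: "([T, dot], xs @ [x]) \<in> S"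
      using S red rd join graded_append[OF join(1), of "[dot]" 0]
      by (auto simp: decorated_iff forests0_iff graded_dot reduced_Cons[of T "[dot]"])
    \<comment> \<open>The left factor and the generator together, which is the generator alone if the tree is \<open>\<bullet>\<close>.\<close>
    have eq_left: "u (basis k ([T, dot], xs @ [x])) = v (basis k ([T, dot], xs @ [x]))"
    proof (cases "T = dot")
      case True
      then have "xs = []" using join(1) by (simp add: graded_dot)
      with True gen join show ?thesis by simp
    next
      case False
      then have "([T], xs) \<in> S" using S red join by (auto simp: decorated_iff forests0_iff gradedD(2))
      then have "u (sh_mult k lam (basis k ([T], xs)) (basis k ([dot, dot], [x])))
         = v (sh_mult k lam (basis k ([T], xs)) (basis k ([dot, dot], [x])))"
        using uD(2) vD(2) j join gen by simp
      then show ?thesis using gen_mult(1) by simp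
    qed
    show ?case
    proof (cases "F = [dot]")
      case True
      then have "ys = []" using join(4) by (simp add: graded_dot)
      with True eq_left show ?thesis by simp
    next
      case False
      then have "(F, ys) \<in> S" using S red join gradedD(2)[OF join(4)] by (auto simp: decorated_iff forests0_iff)
      then have "u (sh_mult k lam (basis k ([T, dot], xs @ [x])) (basis k (F, ys)))
         = v (sh_mult k lam (basis k ([T, dot], xs @ [x])) (basis k (F, ys)))"
        using uD(2) vD(2) left join eq_left by simp
      then show ?thesis using gen_mult(2) by simp
    qed
  qed
  fix p assume "p \<in> S"
  then show "u (basis k p) = v (basis k p)"
    using S * by (cases p) (auto simp: decorated_iff)
qed

end


section \<open>Evaluation of decorated forests\<close>

text \<open>
  The letter \<open>xs ! (l - 1)\<close>, with \<open>l\<close> the number of leaves of the first tree, is the one between that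
  tree and the rest, as the tree itself consumes \<open>l - 1\<close> decorations.
\<close>

function deval :: "('a, 'b, 'c) rb_scheme \<Rightarrow> ('x \<Rightarrow> 'b) \<Rightarrow> pforest \<Rightarrow> 'x list \<Rightarrow> 'b" where
  "deval B \<theta> [] xs = \<one>\<^bsub>B\<^esub>"
| "deval B \<theta> [Br F] xs = (if F = [] then \<one>\<^bsub>B\<^esub> else rbop B (deval B \<theta> F xs))"
| "deval B \<theta> (T # T' # F) xs =
     deval B \<theta> [T] (take (tree_leaves T - 1) xs) \<otimes>\<^bsub>B\<^esub> \<theta> (xs ! (tree_leaves T - 1))
       \<otimes>\<^bsub>B\<^esub> deval B \<theta> (T' # F) (drop (tree_leaves T) xs)"
  by pat_completeness auto
termination
  by (relation "measure (\<lambda>(_, _, F, _). size (Br F))") (simp_all add: size_Br del: ptree.size)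

locale rb_evaluation = weighted_cring k lam + B: unitary_rota_baxter k lam B
  for k :: "('a, 'm) ring_scheme" (structure) and lam and B :: "('a, 'b, 'c) rb_scheme" +
  fixes X :: "'x set" and \<theta> :: "'x \<Rightarrow> 'b"
  assumes \<theta>_closed: "x \<in> X \<Longrightarrow> \<theta> x \<in> carrier B"
begin

abbreviation ev where "ev \<equiv> deval B \<theta>"

lemma ev_tree_join:
  assumes "[T] \<in> graded (length xs)" "F \<noteq> []"
  shows "ev (T # F) (xs @ x # ys) = ev [T] xs \<otimes>\<^bsub>B\<^esub> \<theta> x \<otimes>\<^bsub>B\<^esub> ev F ys"
proof -
  obtain T' F' where F: "F = T' # F'" using assms by (cases F) auto
  have "tree_leaves T = Suc (length xs)" using assms(1) gradedD(3) by fastforce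
  then show ?thesis by (simp add: F nth_append)
qed

lemma ev_closed:
  assumes "F \<in> graded (length xs)" "xs \<in> lists X"
  shows "ev F xs \<in> carrier B"
  using assms
  by (induction F xs rule: decorated_induct)
     (auto simp: ev_tree_join gradedD(2) \<theta>_closed intro!: B.mult_closed B.rbop_closed)

lemma ev_join:
  assumes "F \<in> graded (length xs)" "xs \<in> lists X" "G \<in> graded (length ys)" "ys \<in> lists X" "x \<in> X"
  shows "ev (F @ G) (xs @ x # ys) = ev F xs \<otimes>\<^bsub>B\<^esub> \<theta> x \<otimes>\<^bsub>B\<^esub> ev G ys"
  using assms(1,2)
proof (induction F arbitrary: xs)
  case Nil
  then show ?case using gradedD(2) by blast
next
  case (Cons T F)
  note G = gradedD(2)[OF assms(3)]
  show ?case
  proof (cases "F = []")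
    case True
    then show ?thesis using Cons.prems G by (simp add: ev_tree_join)
  next
    case False
    obtain ts y ws where s: "xs = ts @ y # ws" "[T] \<in> graded (length ts)" "F \<in> graded (length ws)"
      "ts \<in> lists X" "y \<in> X" "ws \<in> lists X"
      using split_decoration[of "[T]" F xs X] Cons.prems False by auto
    have "ev (F @ G) (ws @ x # ys) = ev F ws \<otimes>\<^bsub>B\<^esub> \<theta> x \<otimes>\<^bsub>B\<^esub> ev G ys"
      using Cons.IH s by blast
    then show ?thesis using s False assms
      by (simp add: ev_tree_join ev_closed \<theta>_closed B.mult_closed B.mult_assoc)
  qed
qed

text \<open>
  Evaluation of a combination of forests that all carry the same tuple of decorations; through
  \<^const>\<open>dec\<close> it is the restriction of the full evaluation \<open>sh_ev\<close> below.
\<close>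

definition evl :: "'x list \<Rightarrow> (pforest \<Rightarrow> 'a) \<Rightarrow> 'b" where
  "evl xs = lift k B (\<lambda>F. ev F xs)"

lemma evl_linear: "xs \<in> lists X \<Longrightarrow> linear_on k (graded (length xs)) B (evl xs)"
  unfolding evl_def by (rule lift_linear[OF B.module_axioms]) (rule ev_closed)

lemma evl_basis: "xs \<in> lists X \<Longrightarrow> F \<in> graded (length xs) \<Longrightarrow> evl xs (basis k F) = ev F xs"
  unfolding evl_def by (rule lift_basis[OF B.module_axioms]) (rule ev_closed)

lemma evl_bracket:
  assumes "xs \<in> lists X" "a \<in> free_carrier k (graded (length xs))"
  shows "evl xs (bracket k a) = rbop B (evl xs a)"
proof (rule linear_eqI[OF B.module_axioms _ _ _ assms(2),
      where f = "\<lambda>a. evl xs (bracket k a)" and g = "\<lambda>a. rbop B (evl xs a)"])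
  show "linear_on k (graded (length xs)) B (\<lambda>a. evl xs (bracket k a))"
    by (rule linear_on_compose[OF bracket_linear evl_linear]) (use assms gradedD(2) in \<open>auto simp: graded_Br\<close>)
  show "linear_on k (graded (length xs)) B (\<lambda>a. rbop B (evl xs a))"
    using linear_onD[OF evl_linear[OF assms(1)]]
    by (simp add: linear_on_def B.rbop_add B.rbop_smult B.rbop_closed)
qed (use assms gradedD(2) in \<open>simp add: evl_basis graded_Br\<close>)

text \<open>
  Isolates the only tree on which a product with another forest from the right acts. The element \<open>b\<close> is
  the value of the trees to its left together with the separating letter, and is \<open>1\<close> if there are none; this
  avoids distinguishing forests with one tree from longer ones.
\<close>

lemma split_last_tree:
  assumes "F \<in> graded (length xs)" "xs \<in> lists X"
  obtains us ts b where "xs = us @ ts" "us \<in> lists X" "ts \<in> lists X" "[last F] \<in> graded (length ts)" "b \<in> carrier B"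
    "\<And>n G. G \<in> graded n \<Longrightarrow> butlast F @ G \<in> graded (length us + n)"
    "\<And>G ys. G \<in> graded (length ys) \<Longrightarrow> ys \<in> lists X \<Longrightarrow> ev (butlast F @ G) (us @ ys) = b \<otimes>\<^bsub>B\<^esub> ev G ys"
proof -
  obtain U T where F: "F = U @ [T]" using gradedD(2)[OF assms(1)] by (cases F rule: rev_cases) auto
  show ?thesis
  proof (cases "U = []")
    case True
    then show ?thesis
      by (intro that[of "[]" xs "\<one>\<^bsub>B\<^esub>"]) (use assms F in \<open>auto simp: ev_closed\<close>)
  next
    case False
    obtain us x ts where s: "xs = us @ x # ts" "U \<in> graded (length us)" "[T] \<in> graded (length ts)"
      "us \<in> lists X" "x \<in> X" "ts \<in> lists X"
      using split_decoration[of U "[T]" xs X] assms False by (auto simp: F)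
    show ?thesis
    proof (rule that[of "us @ [x]" ts "ev U us \<otimes>\<^bsub>B\<^esub> \<theta> x"])
      show "ev (butlast F @ G) ((us @ [x]) @ ys) = ev U us \<otimes>\<^bsub>B\<^esub> \<theta> x \<otimes>\<^bsub>B\<^esub> ev G ys"
        if "G \<in> graded (length ys)" "ys \<in> lists X" for G ys
        using that s by (simp add: F ev_join)
      show "butlast F @ G \<in> graded (length (us @ [x]) + n)" if "G \<in> graded n" for n G
        using graded_append[OF s(2) that] by (simp add: F)
    qed (use s in \<open>auto simp: F ev_closed \<theta>_closed B.mult_closed\<close>)
  qed
qed

lemma split_first_tree:
  assumes "F \<in> graded (length xs)" "xs \<in> lists X"
  obtains ts us b where "xs = ts @ us" "us \<in> lists X" "ts \<in> lists X" "[hd F] \<in> graded (length ts)" "b \<in> carrier B"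
    "\<And>n G. G \<in> graded n \<Longrightarrow> G @ tl F \<in> graded (n + length us)"
    "\<And>G ys. G \<in> graded (length ys) \<Longrightarrow> ys \<in> lists X \<Longrightarrow> ev (G @ tl F) (ys @ us) = ev G ys \<otimes>\<^bsub>B\<^esub> b"
proof -
  obtain T W where F: "F = T # W" using gradedD(2)[OF assms(1)] by (cases F) auto
  show ?thesis
  proof (cases "W = []")
    case True
    then show ?thesis
      by (intro that[of xs "[]" "\<one>\<^bsub>B\<^esub>"]) (use assms F in \<open>auto simp: ev_closed\<close>)
  next
    case False
    obtain ts x ws where s: "xs = ts @ x # ws" "[T] \<in> graded (length ts)" "W \<in> graded (length ws)"
      "ts \<in> lists X" "x \<in> X" "ws \<in> lists X"
      using split_decoration[of "[T]" W xs X] assms False by (auto simp: F)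
    show ?thesis
    proof (rule that[of ts "x # ws" "\<theta> x \<otimes>\<^bsub>B\<^esub> ev W ws"])
      show "ev (G @ tl F) (ys @ x # ws) = ev G ys \<otimes>\<^bsub>B\<^esub> (\<theta> x \<otimes>\<^bsub>B\<^esub> ev W ws)"
        if "G \<in> graded (length ys)" "ys \<in> lists X" for G ys
        using that s by (simp add: F ev_join ev_closed \<theta>_closed B.mult_assoc)
      show "G @ tl F \<in> graded (n + length (x # ws))" if "G \<in> graded n" for n G
        using graded_append[OF that s(3)] by (simp add: F)
    qed (use s in \<open>auto simp: F ev_closed \<theta>_closed B.mult_closed\<close>)
  qed
qed

text \<open>
  For two brackets, the three terms of the recursion evaluate, by induction, to the three terms of the
  Rota--Baxter identity in \<open>B\<close>. For forests, the values of the trees that the product does not touch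
  are constant factors on the outer left and right.
\<close>

lemma ev_product:
  shows "[T] \<in> graded (length xs) \<Longrightarrow> xs \<in> lists X \<Longrightarrow> [T'] \<in> graded (length ys) \<Longrightarrow> ys \<in> lists X \<Longrightarrow>
      evl (xs @ ys) (tree_prod k lam T T') = ev [T] xs \<otimes>\<^bsub>B\<^esub> ev [T'] ys"
    and "F \<in> graded (length xs) \<Longrightarrow> xs \<in> lists X \<Longrightarrow> F' \<in> graded (length ys) \<Longrightarrow> ys \<in> lists X \<Longrightarrow>
      evl (xs @ ys) (forest_prod k lam F F') = ev F xs \<otimes>\<^bsub>B\<^esub> ev F' ys"
proof (induction T T' and F F' arbitrary: xs ys and xs ys rule: tree_forest_pair_induct)
  case (dot_right T)
  then show ?case by (simp add: graded_dot evl_basis ev_closed)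
next
  case (dot_left F)
  then have "tree_prod k lam dot (Br F) = basis k [Br F]" by (auto simp: neq_Nil_conv)
  moreover have "ev [Br F] ys \<in> carrier B" using dot_left by (intro ev_closed)
  ultimately show ?case using dot_left by (simp add: graded_dot evl_basis)
next
  case (brackets F F')
  have g: "F \<in> graded (length xs)" "F' \<in> graded (length ys)"
    using brackets by (simp_all add: graded_Br)
  let ?zs = "xs @ ys"
  have zs: "?zs \<in> lists X" using brackets by simp
  have c: "forest_prod k lam [Br F] F' \<in> free_carrier k (graded (length ?zs))"
    "forest_prod k lam F [Br F'] \<in> free_carrier k (graded (length ?zs))"
    "forest_prod k lam F F' \<in> free_carrier k (graded (length ?zs))"
    using brackets g forest_prod_graded by simp_all
  have cb: "a \<in> free_carrier k (graded (length ?zs)) \<Longrightarrow> bracket k a \<in> free_carrier k (graded (length ?zs))" for a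
    by (rule bracket_closed) (auto simp: graded_Br gradedD(2))
  note lin = linear_onD[OF evl_linear[OF zs]]
  have "evl ?zs (tree_prod k lam (Br F) (Br F')) =
     rbop B (evl ?zs (forest_prod k lam [Br F] F')) \<oplus>\<^bsub>B\<^esub> rbop B (evl ?zs (forest_prod k lam F [Br F']))
       \<oplus>\<^bsub>B\<^esub> lam \<odot>\<^bsub>B\<^esub> rbop B (evl ?zs (forest_prod k lam F F'))"
    using brackets(1,2) c cb lin evl_bracket[OF zs]
    by (simp add: tree_prod_brackets fadd_closed fsmult_closed del: length_append)
  also have "\<dots> = rbop B (ev [Br F] xs \<otimes>\<^bsub>B\<^esub> ev F' ys) \<oplus>\<^bsub>B\<^esub> rbop B (ev F xs \<otimes>\<^bsub>B\<^esub> ev [Br F'] ys)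
       \<oplus>\<^bsub>B\<^esub> lam \<odot>\<^bsub>B\<^esub> rbop B (ev F xs \<otimes>\<^bsub>B\<^esub> ev F' ys)"
    using brackets g by (simp only: brackets.IH)
  also have "\<dots> = rbop B (ev F xs) \<otimes>\<^bsub>B\<^esub> rbop B (ev F' ys)"
    using brackets g by (simp add: B.rota_baxter_identity B.rbop_add B.rbop_smult ev_closed B.mult_closed B.rbop_closed)
  finally show ?case using brackets(1,2) by simp
next
  case (forests F F')
  note ne = gradedD(2)[OF forests(2)] gradedD(2)[OF forests(4)]
  obtain us ts b where s: "xs = us @ ts" "us \<in> lists X" "ts \<in> lists X" "[last F] \<in> graded (length ts)" "b \<in> carrier B"
    "\<And>n G. G \<in> graded n \<Longrightarrow> butlast F @ G \<in> graded (length us + n)"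
    "\<And>G ys. G \<in> graded (length ys) \<Longrightarrow> ys \<in> lists X \<Longrightarrow> ev (butlast F @ G) (us @ ys) = b \<otimes>\<^bsub>B\<^esub> ev G ys"
    using split_last_tree[OF forests(2,3)] by metis
  obtain ts' us' b' where s': "ys = ts' @ us'" "us' \<in> lists X" "ts' \<in> lists X" "[hd F'] \<in> graded (length ts')" "b' \<in> carrier B"
    "\<And>n G. G \<in> graded n \<Longrightarrow> G @ tl F' \<in> graded (n + length us')"
    "\<And>G ys. G \<in> graded (length ys) \<Longrightarrow> ys \<in> lists X \<Longrightarrow> ev (G @ tl F') (ys @ us') = ev G ys \<otimes>\<^bsub>B\<^esub> b'"
    using split_first_tree[OF forests(4,5)] by metis
  let ?L = "lin_ext k (\<lambda>G. basis k (butlast F @ G @ tl F'))" and ?ws = "ts @ ts'"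
  have IH: "evl ?ws (tree_prod k lam (last F) (hd F')) = ev [last F] ts \<otimes>\<^bsub>B\<^esub> ev [hd F'] ts'"
    by (rule forests.IH) (use ne s s' in auto)
  have ws: "?ws \<in> lists X" using s s' by simp
  have t: "tree_prod k lam (last F) (hd F') \<in> free_carrier k (graded (length ?ws))"
    using forest_prod_graded[OF s(4) s'(4)] by (simp add: forest_prod_trees)
  have "evl (xs @ ys) (?L (tree_prod k lam (last F) (hd F'))) =
    b \<otimes>\<^bsub>B\<^esub> evl ?ws (tree_prod k lam (last F) (hd F')) \<otimes>\<^bsub>B\<^esub> b'"
  proof (rule linear_eqI[OF B.module_axioms _ _ _ t, where f = "\<lambda>a. evl (xs @ ys) (?L a)"
        and g = "\<lambda>a. b \<otimes>\<^bsub>B\<^esub> evl ?ws a \<otimes>\<^bsub>B\<^esub> b'"])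
    have gr: "butlast F @ G @ tl F' \<in> graded (length (xs @ ys))" if "G \<in> graded (length ?ws)" for G
      using s(6)[OF s'(6)[OF that]] s(1) s'(1) by (simp add: add.assoc)
    show "linear_on k (graded (length ?ws)) B (\<lambda>a. evl (xs @ ys) (?L a))"
      by (rule linear_on_compose[OF lin_ext_linear evl_linear]) (use gr forests in auto)
    show "linear_on k (graded (length ?ws)) B (\<lambda>a. b \<otimes>\<^bsub>B\<^esub> evl ?ws a \<otimes>\<^bsub>B\<^esub> b')"
      using linear_onD[OF evl_linear[OF ws]] s(5) s'(5)
      by (simp add: linear_on_def B.mult_closed B.mult_add_left B.mult_add_right
          B.mult_smult_left B.mult_smult_right)
    fix G assume G: "G \<in> graded (length ?ws)"
    have "ev (butlast F @ G @ tl F') (us @ ?ws @ us') = b \<otimes>\<^bsub>B\<^esub> ev (G @ tl F') (?ws @ us')"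
      using s(7)[of "G @ tl F'" "?ws @ us'"] s'(6)[OF G] ws s'(2) by (simp add: add.assoc)
    also have "ev (G @ tl F') (?ws @ us') = ev G ?ws \<otimes>\<^bsub>B\<^esub> b'"
      by (rule s'(7)[OF G ws])
    finally show "evl (xs @ ys) (?L (basis k G)) = b \<otimes>\<^bsub>B\<^esub> evl ?ws (basis k G) \<otimes>\<^bsub>B\<^esub> b'"
      using gr[OF G] G ws forests(3,5) s s' ev_closed[OF G ws]
      by (simp add: lin_ext_basis[where T = UNIV] evl_basis B.mult_assoc del: length_append)
  qed
  moreover have "ev F xs = b \<otimes>\<^bsub>B\<^esub> ev [last F] ts" "ev F' ys = ev [hd F'] ts' \<otimes>\<^bsub>B\<^esub> b'"
    using s(7)[OF s(4,3)] s'(7)[OF s'(4,3)] s(1) s'(1) ne by simp_all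
  ultimately show ?case using IH ne s s'
    by (simp add: forest_prod_eq ev_closed B.mult_assoc B.mult_closed)
qed

definition sh_ev :: "('x decorated \<Rightarrow> 'a) \<Rightarrow> 'b" where
  "sh_ev = lift k B (\<lambda>p. ev (fst p) (snd p))"

lemma sh_ev_linear: "linear_on k (decorated_forests X) B sh_ev"
  unfolding sh_ev_def by (rule lift_linear[OF B.module_axioms]) (auto simp: decorated_iff intro: ev_closed)

lemma sh_ev_basis: "(F, xs) \<in> decorated_forests X \<Longrightarrow> sh_ev (basis k (F, xs)) = ev F xs"
  unfolding sh_ev_def using lift_basis[OF B.module_axioms, of "\<lambda>p. ev (fst p) (snd p)" "(F, xs)"]
  by (simp add: decorated_iff ev_closed)

lemma sh_ev_dec:
  assumes "xs \<in> lists X" "a \<in> free_carrier k (graded (length xs))"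
  shows "sh_ev (dec xs a) = evl xs a"
  by (rule linear_eqI[OF B.module_axioms linear_on_compose[OF dec_linear_graded sh_ev_linear] evl_linear _ assms(2)])
     (use assms in \<open>auto simp: sh_ev_basis evl_basis decorated_iff\<close>)

lemma sh_ev_mult:
  assumes "a \<in> free_carrier k (decorated_forests X)" "b \<in> free_carrier k (decorated_forests X)"
  shows "sh_ev (sh_mult k lam a b) = sh_ev a \<otimes>\<^bsub>B\<^esub> sh_ev b"
proof (rule bilinear_eqI[OF B.module_axioms _ _ _ assms,
      where f = "\<lambda>a b. sh_ev (sh_mult k lam a b)" and g = "\<lambda>a b. sh_ev a \<otimes>\<^bsub>B\<^esub> sh_ev b"])
  show "bilinear_on k (decorated_forests X) (decorated_forests X) B (\<lambda>a b. sh_ev (sh_mult k lam a b))"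
    by (rule bilinear_on_compose[OF sh_mult_bilinear[OF disjI1[OF refl]] sh_ev_linear])
  show "bilinear_on k (decorated_forests X) (decorated_forests X) B (\<lambda>a b. sh_ev a \<otimes>\<^bsub>B\<^esub> sh_ev b)"
    using linear_onD[OF sh_ev_linear]
    by (simp add: bilinear_on_def linear_on_def B.mult_closed B.mult_add_left B.mult_add_right
          B.mult_smult_left B.mult_smult_right)
  fix p q assume "p \<in> decorated_forests X" "q \<in> decorated_forests X"
  then obtain F xs G ys where p: "p = (F, xs)" "q = (G, ys)"
    and g: "F \<in> graded (length xs)" "G \<in> graded (length ys)" and l: "xs \<in> lists X" "ys \<in> lists X"
    by (cases p; cases q) (auto simp: decorated_iff)
  then show "sh_ev (sh_mult k lam (basis k p) (basis k q)) = sh_ev (basis k p) \<otimes>\<^bsub>B\<^esub> sh_ev (basis k q)"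
    using sh_ev_dec[of "xs @ ys" "forest_prod k lam F G"] ev_product(2)[OF g(1) l(1) g(2) l(2)] forest_prod_graded[OF g]
    by (simp add: sh_mult_basis[where X = X] sh_ev_basis decorated_iff)
qed

lemma sh_ev_op:
  assumes "a \<in> free_carrier k (decorated_forests X)"
  shows "sh_ev (sh_op k a) = rbop B (sh_ev a)"
proof (rule linear_eqI[OF B.module_axioms _ _ _ assms, where f = "\<lambda>a. sh_ev (sh_op k a)" and g = "\<lambda>a. rbop B (sh_ev a)"])
  show "linear_on k (decorated_forests X) B (\<lambda>a. sh_ev (sh_op k a))"
    by (rule linear_on_compose[OF sh_op_linear[OF disjI1[OF refl]] sh_ev_linear])
  show "linear_on k (decorated_forests X) B (\<lambda>a. rbop B (sh_ev a))"
    using linear_onD[OF sh_ev_linear]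
    by (simp add: linear_on_def B.rbop_add B.rbop_smult B.rbop_closed)
  fix p assume "p \<in> decorated_forests X"
  moreover obtain F xs where p: "p = (F, xs)" by (cases p)
  ultimately have F: "F \<in> graded (length xs)" "xs \<in> lists X" by (simp_all add: decorated_iff)
  with gradedD(2) have "F \<noteq> []" by blast
  with F show "sh_ev (sh_op k (basis k p)) = rbop B (sh_ev (basis k p))"
    by (simp add: p sh_ev_basis decorated_iff graded_Br)
qed

lemma sh_ev_hom: "restrict sh_ev (free_carrier k (decorated_forests X)) \<in> unitary_rb_hom k (Sh_NC k lam X) B"
proof -
  have d: "([dot], []) \<in> decorated_forests X" by (simp add: decorated_iff graded_dot)
  have m: "\<lbrakk>a \<in> free_carrier k (decorated_forests X); b \<in> free_carrier k (decorated_forests X)\<rbrakk> \<Longrightarrow> sh_mult k lam a b \<in> free_carrier k (decorated_forests X)" for a b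
    using bilinear_onD(1)[OF sh_mult_bilinear[OF disjI1[OF refl]]] by simp
  have p: "a \<in> free_carrier k (decorated_forests X) \<Longrightarrow> sh_op k a \<in> free_carrier k (decorated_forests X)" for a
    using linear_onD(1)[OF sh_op_linear[OF disjI1[OF refl]]] by simp
  show ?thesis
    using linear_onD[OF sh_ev_linear] sh_ev_mult sh_ev_op sh_ev_basis[OF d] d m p
    by (simp add: unitary_rb_hom_def rb_hom_def Sh_NC_def fadd_closed fsmult_closed)
qed

lemma sh_ev_generator: "x \<in> X \<Longrightarrow> sh_ev (basis k ([dot, dot], [x])) = \<theta> x"
  by (simp add: sh_ev_basis decorated_iff graded_def forests_def \<theta>_closed)

end


section \<open>The unitarization\<close>

context weighted_cring
begin

text \<open>
  The two algebras have the same operations on nested carriers.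
\<close>

lemma inclusion_hom: "restrict (\<lambda>a. a) (carrier (Sh_NC0 k lam X)) \<in> rb_hom k (Sh_NC0 k lam X) (Sh_NC k lam X)"
proof -
  interpret A: rota_baxter k lam "Sh_NC0 k lam X" by (rule Sh_NC0_rota_baxter)
  have "carrier (Sh_NC0 k lam X) \<subseteq> carrier (Sh_NC k lam X)"
    unfolding Sh_NC0_def by (auto simp: Sh_NC_def intro: subsetD[OF free_carrier_mono, rotated])
  moreover have "add (Sh_NC0 k lam X) = add (Sh_NC k lam X)" "smult (Sh_NC0 k lam X) = smult (Sh_NC k lam X)"
    "mult (Sh_NC0 k lam X) = mult (Sh_NC k lam X)" "rbop (Sh_NC0 k lam X) = rbop (Sh_NC k lam X)"
    by (simp_all add: Sh_NC0_def)
  ultimately show ?thesis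
    using A.a_closed A.mult_closed A.smult_closed A.rbop_closed by (auto simp: rb_hom_def)
qed

lemma Sh_NC0_hom_eqI:
  assumes "module k B" "u \<in> rb_hom k (Sh_NC0 k lam X) B" "v \<in> rb_hom k (Sh_NC0 k lam X) B"
    "\<And>x. x \<in> X \<Longrightarrow> u (j_NC0 k x) = v (j_NC0 k x)" "a \<in> carrier (Sh_NC0 k lam X)"
  shows "u a = v a"
  by (rule rb_hom_eqI[where S = "reduced_decorated X" and X = X and A = "Sh_NC0 k lam X" and u = u and v = v and a = a and B = B])
     (use assms in \<open>auto simp: Sh_NC0_def Sh_NC_def j_NC0_def forests0_iff\<close>)

lemma Sh_NC_hom_eqI:
  assumes "module k B" "u \<in> unitary_rb_hom k (Sh_NC k lam X) B" "v \<in> unitary_rb_hom k (Sh_NC k lam X) B"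
    "\<And>x. x \<in> X \<Longrightarrow> u (j_NC0 k x) = v (j_NC0 k x)" "a \<in> carrier (Sh_NC k lam X)"
  shows "u a = v a"
  by (rule rb_hom_eqI[where S = "decorated_forests X" and X = X and A = "Sh_NC k lam X" and u = u and v = v and a = a and B = B])
     (use assms in \<open>auto simp: Sh_NC_def j_NC0_def unitary_rb_hom_def\<close>)

lemma j_NC0_closed: "x \<in> X \<Longrightarrow> j_NC0 k x \<in> carrier (Sh_NC0 k lam X)"
  by (auto simp: j_NC0_def Sh_NC0_def Sh_NC_def decorated_iff graded_def forests_def forests0_iff reduced_def
      intro!: basis_closed)

lemma u_NC_unique: "\<exists>!u. is_u_NC k lam X u"
proof (rule ex1I)
  interpret A: rota_baxter k lam "Sh_NC k lam X" by (rule Sh_NC_rota_baxter)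
  let ?i = "restrict (\<lambda>a. a) (carrier (Sh_NC0 k lam X))"
  show i: "is_u_NC k lam X ?i"
    by (auto simp: is_u_NC_def j_NC_def j_NC0_def j_NC0_closed[unfolded j_NC0_def] inclusion_hom)
  fix u assume u: "is_u_NC k lam X u"
  have "u a = ?i a" if "a \<in> carrier (Sh_NC0 k lam X)" for a
    by (rule Sh_NC0_hom_eqI[OF A.module_axioms _ inclusion_hom _ that])
       (use u i in \<open>auto simp: is_u_NC_def\<close>)
  moreover have "u \<in> extensional (carrier (Sh_NC0 k lam X))"
    using u by (auto simp: is_u_NC_def rb_hom_def PiE_def)
  ultimately show "u = ?i" by (intro extensionalityI[where A = "carrier (Sh_NC0 k lam X)"]) auto
qed

lemma u_NC_eq: "u_NC k lam X = restrict (\<lambda>a. a) (carrier (Sh_NC0 k lam X))"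
  unfolding u_NC_def
  by (rule the1_equality[OF u_NC_unique])
     (auto simp: is_u_NC_def j_NC_def j_NC0_def j_NC0_closed[unfolded j_NC0_def] inclusion_hom)

text \<open>
  The extension is the evaluation at \<open>x \<mapsto> f (j x)\<close>. Its composite with \<open>u\<close> is a homomorphism of
  nonunitary algebras that agrees with \<open>f\<close> on generators, so it equals \<open>f\<close>; any other extension
  agrees with it on generators as well.
\<close>

lemma unitarization_factor:
  fixes B :: "('a, 't) rb"
  assumes B: "unitary_rota_baxter k lam B" and f: "f \<in> rb_hom k (Sh_NC0 k lam X) B"
  shows "\<exists>!g. g \<in> unitary_rb_hom k (Sh_NC k lam X) B \<and>
    (\<forall>a\<in>carrier (Sh_NC0 k lam X). f a = g (u_NC k lam X a))"
proof -
  interpret B: unitary_rota_baxter k lam B by fact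
  interpret E: rb_evaluation k lam B X "\<lambda>x. f (j_NC0 k x)"
    by (intro rb_evaluation.intro weighted_cring_axioms B rb_evaluation_axioms.intro
        rb_homD(1)[OF f j_NC0_closed])
  have sub: "carrier (Sh_NC0 k lam X) \<subseteq> carrier (Sh_NC k lam X)"
    unfolding Sh_NC0_def by (auto simp: Sh_NC_def intro: subsetD[OF free_carrier_mono, rotated])
  have car: "carrier (Sh_NC k lam X) = free_carrier k (decorated_forests X)" by (simp add: Sh_NC_def)
  let ?g = "restrict E.sh_ev (free_carrier k (decorated_forests X))"
  have gen: "?g (j_NC0 k x) = f (j_NC0 k x)" if "x \<in> X" for x
    using E.sh_ev_generator[OF that] subsetD[OF sub j_NC0_closed[OF that]] car by (simp add: j_NC0_def)
  have hom: "?g \<in> unitary_rb_hom k (Sh_NC k lam X) B" by (rule E.sh_ev_hom)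
  have "u_NC k lam X \<in> rb_hom k (Sh_NC0 k lam X) (Sh_NC k lam X)"
    unfolding u_NC_eq by (rule inclusion_hom)
  then have comp: "restrict (\<lambda>a. ?g (u_NC k lam X a)) (carrier (Sh_NC0 k lam X)) \<in> rb_hom k (Sh_NC0 k lam X) B"
    by (rule rb_hom_compose[OF Sh_NC0_rota_baxter]) (use hom in \<open>unfold unitary_rb_hom_def, blast\<close>)
  show ?thesis
  proof (rule ex1I[of _ ?g], intro conjI ballI)
    show "?g \<in> unitary_rb_hom k (Sh_NC k lam X) B" by (rule hom)
    fix a assume a: "a \<in> carrier (Sh_NC0 k lam X)"
    have "f a = restrict (\<lambda>a. ?g (u_NC k lam X a)) (carrier (Sh_NC0 k lam X)) a"
      by (rule Sh_NC0_hom_eqI[OF B.module_axioms f comp _ a]) (simp add: u_NC_eq j_NC0_closed gen restrict_apply' del: restrict_apply)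
    then show "f a = ?g (u_NC k lam X a)" using a by simp
  next
    fix g assume g: "g \<in> unitary_rb_hom k (Sh_NC k lam X) B \<and>
      (\<forall>a\<in>carrier (Sh_NC0 k lam X). f a = g (u_NC k lam X a))"
    have "g a = ?g a" if a: "a \<in> carrier (Sh_NC k lam X)" for a
      by (rule Sh_NC_hom_eqI[OF B.module_axioms conjunct1[OF g] hom _ a])
         (use g gen in \<open>auto simp: u_NC_eq j_NC0_closed\<close>)
    moreover have "g \<in> extensional (carrier (Sh_NC k lam X))" "?g \<in> extensional (carrier (Sh_NC k lam X))"
      using g by (auto simp: unitary_rb_hom_def rb_hom_def PiE_def car)
    ultimately show "g = ?g" by (intro extensionalityI[where A = "carrier (Sh_NC k lam X)"]) auto
  qed
qed

end

theorem theorem4p2: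
  fixes k :: "('a, 'm) ring_scheme" and lam :: 'a and X :: "'x set"
  assumes "cring k" and "lam \<in> carrier k"
  shows "(\<exists>!u. is_u_NC k lam X u) \<and>
    is_unitarization TYPE('t) k lam (Sh_NC0 k lam X) (Sh_NC k lam X) (u_NC k lam X)"
proof -
  interpret weighted_cring k lam
    using assms by (simp add: weighted_cring_def weighted_cring_axioms_def)
  have "u_NC k lam X \<in> rb_hom k (Sh_NC0 k lam X) (Sh_NC k lam X)"
    unfolding u_NC_eq by (rule inclusion_hom)
  then have "is_unitarization TYPE('t) k lam (Sh_NC0 k lam X) (Sh_NC k lam X) (u_NC k lam X)"
    unfolding is_unitarization_def
    by (intro conjI allI impI ballI unitarization_factor Sh_NC0_rota_baxter Sh_NC_unitary)
  with u_NC_unique show ?thesis by (rule conjI)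
qed


end
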